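(* Let $n,m,N$ be positive integers, let $A\in c_0(\mathbb{Z}^n)^N$ be an index set, and let $C(A)\subset\mathbb{C}^N$ be the Sobolev moment cone. For any integers $r\ge d_A$ and $\rho\ge\rho_A$, the set $C^{\mathrm{out}}_{r,\rho}(A)$ is a semidefinite representable outer approximation of $C(A)$, i.e. it is semidefinite representable and $C(A)\subseteq C^{\mathrm{out}}_{r,\rho}(A)$.
   Context: Setting. $T^n=\mathbb{R}^n/\mathbb{Z}^n$ is the unit torus; for $a\in\mathbb{Z}^n$, $e_a(x):=e^{-2\pi \mathbf{i}\langle a,x\rangle}$, and the Fourier coefficients of $f\in L^2(T^n)$, $f:T^n\to\mathbb{C}$, are $c_a=\langle f,e_a\rangle_{L^2}:=\int_{T^n}f(x)e_a(x)dx$. Put $w_a:=(1+\langle a,a\rangle)^m$ and $\|f\|^2_{H^m(T^n)}:=\sum_{a\in\mathbb{Z}^n}w_a|c_a|^2$. $H^m(T^n)$ is the Sobolev space of functions $f:T^n\to\mathbb{C}$ in $L^2$ with $\|f\|_{H^m(T^n)}<\infty$, and $B:=\{f\in H^m(T^n):\|f\|_{H^m(T^n)}\le1\}$, with the topology inherited from $L^2(T^n)$. "Measure" means non-negative Radon measure (locally finite and tight). $c_0(\mathbb{Z}^n)$ is the set of finite collections $\mathbf a$ of elements of $\mathbb{Z}^n$, repetitions allowed, including $\emptyset$. The algebraic degree $d_{\mathbf a}$ is the number of terms of $\mathbf a$; the harmonic degree is $\delta_{\mathbf a}:=\max_{a\in\mathbf a}\max_i|a_i|$ (and $0$ for $\emptyset$);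 for $a\in\mathbb{Z}^n$, $\delta_a:=\max_i|a_i|$. $d_A:=\max_{\mathbf a\in A}d_{\mathbf a}$, $\rho_A:=\max_{\mathbf a\in A}\delta_{\mathbf a}$. Moment cone. $C(A):=\{(y_{\mathbf a})_{\mathbf a\in A}: y_{\mathbf a}=\int_B\prod_{a\in\mathbf a}\langle f,e_a\rangle_{L^2}\,d\mu(f)\text{ for some measure }\mu\text{ supported on }B\}$. Outer cone. $\mathbb{C}[c]$ is the ring of complex polynomials in the indeterminates $c=(c_a)_{a\in\mathbb{Z}^n}$ with monomials $c^{\mathbf a}:=\prod_{a\in\mathbf a}c_a$; the squared modulus $|c_a|^2$ is written as the monomial $c_ac_{-a}$, and $q^*$ denotes the Hermitian conjugate of $q\in\mathbb{C}[c]$ (conjugate the coefficients and set $c_a^*=c_{-a}$). The degrees $d(p),\delta(p)$ of a polynomial are the maxima of $d_{\mathbf a},\delta_{\mathbf a}$ over its monomials. $\mathbb{C}[c]_{r,\rho}:=\{p:d(p)\le r,\ \delta(p)\le\rho\}$, $\Sigma_{r,\rho}:=\{\sum_kq_k^*q_k:q_k\in\mathbb{C}[c]_{r,\rho}\}$ (finite sums; $\Sigma_{-1,\rho}:=\{0\}$), and $Q_{r,\rho}:=\{s_0+s_1(1-\sum_{a\in\mathbb{Z}^n,\delta_a\le\rho}w_a|c_a|^2):s_0\in\Sigma_{r,\rho},\ s_1\in\Sigma_{r-1,\rho}\}$. For a square-summable family $y=(y_{\mathbf a})_{\mathbf a\in c_0(\mathbb{Z}^n)}$ let $\ell_y(\sum_{\mathbf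 a}p_{\mathbf a}c^{\mathbf a}):=\sum_{\mathbf a}p_{\mathbf a}y_{\mathbf a}$, and let $\Pi_A y:=(y_{\mathbf a})_{\mathbf a\in A}$. Then $C^{\mathrm{out}}_{r,\rho}(A):=\Pi_A\{y : \ell_y(p)\ge0\text{ for all }p\in Q_{r,\rho}\}$. A set is semidefinite representable if it is a projection of a spectrahedron, i.e. of an affine section of the semidefinite cone.
   Formalization: C(A) is formed only from measures on those f in B with |c_a|^2 = c_a c_{-a} for all a (real-valued f); for complex-valued f the inclusion fails, e.g. the Dirac measure at f = i/2 with A = ({0,0}) gives -1/4, while the outer cone requires a nonnegative value. *)

theory Defs
  imports "HOL-Analysis.Analysis" "HOL-Library.Poly_Mapping" "HOL-Library.Multiset"
begin

section \<open>Square-integrable functions on the torus\<close>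

text \<open>
  Functions on the torus are represented by functions on \<open>real ^ 'n\<close> that are invariant under integer
  translations; integration over the torus is integration over the unit cube.
\<close>

definition int_vec :: "int ^ 'n \<Rightarrow> real ^ 'n" where
  "int_vec a = (\<chi> i. of_int (a $ i))"

abbreviation torus_measure :: "(real ^ 'n) measure" where
  "torus_measure \<equiv> lebesgue_on (cbox 0 1)"

definition square_integrable :: "(real ^ 'n \<Rightarrow> complex) \<Rightarrow> bool" where
  "square_integrable f \<longleftrightarrow>
     (\<forall>x k. f (x + int_vec k) = f x) \<and> f \<in> borel_measurable torus_measure \<and>
     integrable torus_measure (\<lambda>x. (cmod (f x))\<^sup>2)"

definition l2_eq :: "(real ^ 'n \<Rightarrow> complex) \<Rightarrow> (real ^ 'n \<Rightarrow> complex) \<Rightarrow> bool" where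
  "l2_eq f g \<longleftrightarrow> square_integrable f \<and> square_integrable g \<and> (AE x in torus_measure. f x = g x)"

lemma l2_eq_part_equivp: "part_equivp l2_eq"
proof (rule part_equivpI)
  show "\<exists>f. l2_eq f f"
    by (rule exI[of _ "\<lambda>_. 0"]) (simp add: l2_eq_def square_integrable_def)
  show "symp l2_eq"
    by (auto simp: symp_def l2_eq_def elim: eventually_mono)
  show "transp l2_eq"
    by (auto simp: transp_def l2_eq_def elim: eventually_elim2)
qed

quotient_type (overloaded) 'n l2_torus = "real ^ ('n::finite) \<Rightarrow> complex" / partial: l2_eq
  by (rule l2_eq_part_equivp)

lemma square_integrable_diff_integrable:
  assumes "square_integrable f" "square_integrable g"
  shows "integrable torus_measure (\<lambda>x. (cmod (f x - g x))\<^sup>2)"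
proof (rule Bochner_Integration.integrable_bound)
  show "integrable torus_measure (\<lambda>x. 2 * (cmod (f x))\<^sup>2 + 2 * (cmod (g x))\<^sup>2)"
    using assms by (auto simp: square_integrable_def)
  show "(\<lambda>x. (cmod (f x - g x))\<^sup>2) \<in> borel_measurable torus_measure"
    using assms by (auto simp: square_integrable_def)
  have "(cmod (a - b))\<^sup>2 \<le> 2 * (cmod a)\<^sup>2 + 2 * (cmod b)\<^sup>2" for a b
  proof -
    have "(cmod (a - b))\<^sup>2 \<le> (cmod a + cmod b)\<^sup>2"
      by (intro power_mono norm_triangle_ineq4) auto
    also have "\<dots> \<le> 2 * (cmod a)\<^sup>2 + 2 * (cmod b)\<^sup>2"
      using zero_le_power2[of "cmod a - cmod b"] by (simp add: power2_eq_square algebra_simps)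
    finally show ?thesis .
  qed
  then show "AE x in torus_measure.
      norm ((cmod (f x - g x))\<^sup>2) \<le> norm (2 * (cmod (f x))\<^sup>2 + 2 * (cmod (g x))\<^sup>2)"
    by (intro AE_I2) simp
qed

lemma l2_triangle:
  fixes f g h :: "real ^ 'n \<Rightarrow> complex"
  assumes f: "square_integrable f" and g: "square_integrable g" and h: "square_integrable h"
  shows "sqrt (LINT x|torus_measure. (cmod (f x - g x))\<^sup>2)
    \<le> sqrt (LINT x|torus_measure. (cmod (f x - h x))\<^sup>2)
      + sqrt (LINT x|torus_measure. (cmod (g x - h x))\<^sup>2)"
proof -
  define N where "N u v = (LINT x|torus_measure. (cmod (u x - v x))\<^sup>2)"
    for u v :: "real ^ 'n \<Rightarrow> complex"
  define a b where "a = sqrt (N f h)" and "b = sqrt (N g h)"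
  have nn: "N u v \<ge> 0" for u v unfolding N_def by simp
  have a: "a \<ge> 0" "a\<^sup>2 = N f h" and b: "b \<ge> 0" "b\<^sup>2 = N g h"
    by (auto simp: a_def b_def nn)
  have key: "N f g \<le> (1 + s / t) * a\<^sup>2 + (1 + t / s) * b\<^sup>2" if st: "s > 0" "t > 0" for s t :: real
  proof -
    have pt: "(cmod (f x - g x))\<^sup>2
        \<le> (1 + s / t) * (cmod (f x - h x))\<^sup>2 + (1 + t / s) * (cmod (g x - h x))\<^sup>2" for x
    proof -
      define p q where "p = cmod (f x - h x)" and "q = cmod (g x - h x)"
      have "cmod (f x - g x) \<le> p + q"
        unfolding p_def q_def by (metis dist_commute dist_norm dist_triangle)
      then have "(cmod (f x - g x))\<^sup>2 \<le> (p + q)\<^sup>2"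
        by (intro power_mono) auto
      also have "\<dots> \<le> (1 + s / t) * p\<^sup>2 + (1 + t / s) * q\<^sup>2"
      proof -
        have "(1 + s / t) * p\<^sup>2 + (1 + t / s) * q\<^sup>2 - (p + q)\<^sup>2 = (s * p - t * q)\<^sup>2 / (s * t)"
          using st by (simp add: field_simps power2_eq_square)
        then show ?thesis
          using st by (smt (verit) divide_nonneg_pos mult_pos_pos zero_le_power2)
      qed
      finally show ?thesis by (simp add: p_def q_def)
    qed
    have "N f g \<le> (LINT x|torus_measure.
        (1 + s / t) * (cmod (f x - h x))\<^sup>2 + (1 + t / s) * (cmod (g x - h x))\<^sup>2)"
      unfolding N_def using pt f g h
      by (intro integral_mono Bochner_Integration.integrable_add integrable_mult_right
          square_integrable_diff_integrable)
    also have "\<dots> = (1 + s / t) * a\<^sup>2 + (1 + t / s) * b\<^sup>2"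
      unfolding a(2) b(2) N_def using f g h
      by (subst Bochner_Integration.integral_add)
        (auto intro!: integrable_mult_right square_integrable_diff_integrable)
    finally show ?thesis .
  qed
  have "N f g \<le> (a + b + e)\<^sup>2" if "e > 0" for e
  proof -
    define a' b' where "a' = a + e / 2" and "b' = b + e / 2"
    have pos: "a' > 0" "b' > 0" using a b that by (auto simp: a'_def b'_def)
    have le: "a\<^sup>2 \<le> a'\<^sup>2" "b\<^sup>2 \<le> b'\<^sup>2"
      using a(1) b(1) that unfolding a'_def b'_def by (intro power_mono; simp)+
    have "N f g \<le> (1 + b' / a') * a\<^sup>2 + (1 + a' / b') * b\<^sup>2"
      using key[OF pos(2,1)] .
    also have "\<dots> \<le> (1 + b' / a') * a'\<^sup>2 + (1 + a' / b') * b'\<^sup>2"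
      using pos le by (intro add_mono mult_left_mono) auto
    also have "\<dots> = (a' + b')\<^sup>2"
      using pos by (simp add: field_simps power2_eq_square)
    also have "a' + b' = a + b + e" by (simp add: a'_def b'_def)
    finally show ?thesis .
  qed
  then have "sqrt (N f g) \<le> a + b + e" if "e > 0" for e
    using a b that by (intro real_le_lsqrt) (auto simp: nn)
  then have "sqrt (N f g) \<le> a + b"
    by (rule field_le_epsilon)
  then show ?thesis by (simp add: a_def b_def N_def)
qed

instantiation l2_torus :: (finite) metric_space
begin

lift_definition dist_l2_torus :: "'a l2_torus \<Rightarrow> 'a l2_torus \<Rightarrow> real" is
  "\<lambda>f g. sqrt (LINT x|torus_measure. (cmod (f x - g x))\<^sup>2)"
proof -
  fix f f' g g' :: "real ^ 'a \<Rightarrow> complex"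
  assume ff': "l2_eq f f'" and gg': "l2_eq g g'"
  have "AE x in torus_measure. (cmod (f x - g x))\<^sup>2 = (cmod (f' x - g' x))\<^sup>2"
    using ff' gg' by (auto simp: l2_eq_def elim: eventually_elim2)
  then have "(LINT x|torus_measure. (cmod (f x - g x))\<^sup>2)
      = (LINT x|torus_measure. (cmod (f' x - g' x))\<^sup>2)"
    using ff' gg' by (intro integral_cong_AE) (auto simp: l2_eq_def square_integrable_def)
  then show "sqrt (LINT x|torus_measure. (cmod (f x - g x))\<^sup>2)
      = sqrt (LINT x|torus_measure. (cmod (f' x - g' x))\<^sup>2)"
    by simp
qed

definition uniformity_l2_torus :: "('a l2_torus \<times> 'a l2_torus) filter" where
  "uniformity_l2_torus = (INF e\<in>{0<..}. principal {(x, y). dist x y < e})"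

definition open_l2_torus :: "'a l2_torus set \<Rightarrow> bool" where
  "open_l2_torus U \<longleftrightarrow> (\<forall>x\<in>U. eventually (\<lambda>(x', y). x' = x \<longrightarrow> y \<in> U) uniformity)"

instance
proof
  show "dist x y = 0 \<longleftrightarrow> x = y" for x y :: "'a l2_torus"
  proof (transfer)
    fix f g :: "real ^ 'a \<Rightarrow> complex"
    assume fg: "l2_eq f f" "l2_eq g g"
    have "(LINT x|torus_measure. (cmod (f x - g x))\<^sup>2) = 0
        \<longleftrightarrow> (AE x in torus_measure. (cmod (f x - g x))\<^sup>2 = 0)"
      using fg by (intro integral_nonneg_eq_0_iff_AE square_integrable_diff_integrable)
        (auto simp: l2_eq_def)
    then show "sqrt (LINT x|torus_measure. (cmod (f x - g x))\<^sup>2) = 0 \<longleftrightarrow> l2_eq f g"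
      using fg by (simp add: l2_eq_def)
  qed
  show "dist x y \<le> dist x z + dist y z" for x y z :: "'a l2_torus"
    by transfer (simp add: l2_eq_def l2_triangle)
qed (simp_all add: uniformity_l2_torus_def open_l2_torus_def)

end

section \<open>Fourier coefficients and Sobolev balls\<close>

definition fourier_char :: "int ^ 'n \<Rightarrow> real ^ 'n \<Rightarrow> complex" where
  "fourier_char a x = exp (- 2 * pi * \<i> * of_real (int_vec a \<bullet> x))"

lemma fourier_char_measurable: "fourier_char a \<in> borel_measurable torus_measure"
proof -
  have "continuous_on (cbox 0 1) (fourier_char a)"
    unfolding fourier_char_def by (intro continuous_intros)
  then show ?thesis
    by (rule continuous_imp_measurable_on_sets_lebesgue) simp
qed

text \<open>
  The pairing is bilinear: the character is not conjugated, so these are the usual Fourier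
  coefficients.
\<close>

lift_definition fourier_coeff :: "('n::finite) l2_torus \<Rightarrow> int ^ 'n \<Rightarrow> complex" is
  "\<lambda>f a. LINT x|torus_measure. f x * fourier_char a x"
proof -
  fix f g :: "real ^ 'n \<Rightarrow> complex"
  assume fg: "l2_eq f g"
  show "(\<lambda>a. LINT x|torus_measure. f x * fourier_char a x)
      = (\<lambda>a. LINT x|torus_measure. g x * fourier_char a x)"
    using fg
    by (intro ext integral_cong_AE borel_measurable_times fourier_char_measurable)
      (auto simp: l2_eq_def square_integrable_def elim: eventually_mono)
qed

definition sobolev_weight :: "nat \<Rightarrow> int ^ 'n \<Rightarrow> real" where
  "sobolev_weight m a = (1 + int_vec a \<bullet> int_vec a) ^ m"

definition sobolev_space :: "nat \<Rightarrow> ('n::finite) l2_torus set" where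
  "sobolev_space m = {f. (\<lambda>a. sobolev_weight m a * (cmod (fourier_coeff f a))\<^sup>2) summable_on UNIV}"

definition sobolev_norm :: "nat \<Rightarrow> ('n::finite) l2_torus \<Rightarrow> real" where
  "sobolev_norm m f = sqrt (\<Sum>\<^sub>\<infinity>a. sobolev_weight m a * (cmod (fourier_coeff f a))\<^sup>2)"

definition sobolev_ball :: "nat \<Rightarrow> ('n::finite) l2_torus set" where
  "sobolev_ball m = {f \<in> sobolev_space m. sobolev_norm m f \<le> 1}"

text \<open>
  The squared modulus of \<open>c\<^sub>a\<close> is the monomial \<open>c\<^sub>a c\<^sub>-\<^sub>a\<close>, and the formal conjugate of \<open>c\<^sub>a\<close> is \<open>c\<^sub>-\<^sub>a\<close>.
  These identifications are valid for the following functions only, which are those that are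
  real-valued almost everywhere.  Over all complex-valued functions the outer cone does not contain
  the moment cone: the constant function \<open>\<i>/2\<close> has \<open>c\<^sub>0\<^sup>2 < 0\<close>, whereas \<open>c\<^sub>0\<^sup>2\<close> is formally the
  Hermitian square of \<open>c\<^sub>0\<close>.
\<close>

definition modulus_symmetric :: "('n::finite) l2_torus set" where
  "modulus_symmetric =
     {f. \<forall>a. of_real ((cmod (fourier_coeff f a))\<^sup>2) = fourier_coeff f a * fourier_coeff f (- a)}"

section \<open>Moment cone\<close>

text \<open>
  Borel measures on the subspace \<open>S\<close> that are locally finite and tight.  Together these imply that the
  measure is finite, and inner regularity then holds as well because the ambient space is metric.
\<close>

definition radon_measure_on :: "'a::metric_space set \<Rightarrow> 'a measure \<Rightarrow> bool" where
  "radon_measure_on S \<mu> \<longleftrightarrow>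
     sets \<mu> = sets (restrict_space borel S) \<and>
     (\<forall>x\<in>S. \<exists>U. open U \<and> x \<in> U \<and> emeasure \<mu> (U \<inter> S) < \<infinity>) \<and>
     (\<forall>e>0. \<exists>K\<subseteq>S. compact K \<and> emeasure \<mu> (S - K) < ennreal e)"

text \<open>
  Finite collections of multi-indices with repetitions are multisets, and families of \<open>N\<close> of them
  are vectors indexed by a finite type.
\<close>

definition moment_cone :: "nat \<Rightarrow> (int ^ 'n) multiset ^ 'k \<Rightarrow> (complex ^ 'k) set" where
  "moment_cone m A =
     {y. \<exists>\<mu>. radon_measure_on (sobolev_ball m \<inter> modulus_symmetric) \<mu> \<and>
          (\<forall>i. y $ i = (LINT f|\<mu>. (\<Prod>a\<in>#A $ i. fourier_coeff f a)))}"

definition index_degree :: "int ^ 'n \<Rightarrow> int" where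
  "index_degree a = Max (range (\<lambda>i. \<bar>a $ i\<bar>))"

definition harmonic_degree :: "(int ^ 'n) multiset \<Rightarrow> int" where
  "harmonic_degree M = Max (insert 0 (index_degree ` set_mset M))"

definition max_algebraic_degree :: "(int ^ 'n) multiset ^ 'k \<Rightarrow> int" where
  "max_algebraic_degree A = Max (range (\<lambda>i. int (size (A $ i))))"

definition max_harmonic_degree :: "(int ^ 'n) multiset ^ 'k \<Rightarrow> int" where
  "max_harmonic_degree A = Max (range (\<lambda>i. harmonic_degree (A $ i)))"

section \<open>Outer cone\<close>

text \<open>
  The polynomial ring in the indeterminates \<open>c\<^sub>a\<close> is the monoid algebra over the multisets of indices,
  the multiset \<open>M\<close> being the monomial that is the product of the \<open>c\<^sub>a\<close> with \<open>a\<close> in \<open>M\<close>.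
\<close>

type_synonym 'n cpoly = "(int ^ 'n) multiset \<Rightarrow>\<^sub>0 complex"

definition poly_conj :: "('n::finite) cpoly \<Rightarrow> 'n cpoly" where
  "poly_conj q =
     (\<Sum>M\<in>Poly_Mapping.keys q. Poly_Mapping.single (image_mset uminus M) (cnj (Poly_Mapping.lookup q M)))"

text \<open>Only the zero polynomial satisfies the degree bound for \<open>r < 0\<close>.\<close>

definition cpoly_bounded :: "int \<Rightarrow> int \<Rightarrow> ('n::finite) cpoly set" where
  "cpoly_bounded r \<rho> = {p. \<forall>M\<in>Poly_Mapping.keys p. int (size M) \<le> r \<and> harmonic_degree M \<le> \<rho>}"

definition sos_cone :: "int \<Rightarrow> int \<Rightarrow> ('n::finite) cpoly set" where
  "sos_cone r \<rho> = {\<Sum>k<K. poly_conj (q k) * q k | (K::nat) q. \<forall>k<K. q k \<in> cpoly_bounded r \<rho>}"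

definition ball_poly :: "nat \<Rightarrow> int \<Rightarrow> ('n::finite) cpoly" where
  "ball_poly m \<rho> =
     1 - (\<Sum>a | index_degree a \<le> \<rho>. Poly_Mapping.single {#a, - a#} (of_real (sobolev_weight m a)))"

definition quad_module :: "nat \<Rightarrow> int \<Rightarrow> int \<Rightarrow> ('n::finite) cpoly set" where
  "quad_module m r \<rho> = {s0 + s1 * ball_poly m \<rho> | s0 s1. s0 \<in> sos_cone r \<rho> \<and> s1 \<in> sos_cone (r - 1) \<rho>}"

definition riesz :: "((int ^ 'n) multiset \<Rightarrow> complex) \<Rightarrow> ('n::finite) cpoly \<Rightarrow> complex" where
  "riesz y p = (\<Sum>M\<in>Poly_Mapping.keys p. Poly_Mapping.lookup p M * y M)"

definition outer_cone :: "nat \<Rightarrow> int \<Rightarrow> int \<Rightarrow> (int ^ 'n) multiset ^ 'k \<Rightarrow> (complex ^ 'k) set" where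
  "outer_cone m r \<rho> A =
     (\<lambda>y. \<chi> i. y (A $ i)) `
       {y. (\<lambda>M. (cmod (y M))\<^sup>2) summable_on UNIV \<and> (\<forall>p\<in>quad_module m r \<rho>. riesz y p \<in> \<real>\<^sub>\<ge>\<^sub>0)}"

section \<open>Semidefinite representability\<close>

text \<open>
  Matrices of size \<open>d\<close> are functions of two indices below \<open>d\<close>; values at other indices are irrelevant.
\<close>

definition psd_matrix :: "nat \<Rightarrow> (nat \<Rightarrow> nat \<Rightarrow> real) \<Rightarrow> bool" where
  "psd_matrix d X \<longleftrightarrow>
     (\<forall>i<d. \<forall>j<d. X i j = X j i) \<and> (\<forall>v. 0 \<le> (\<Sum>i<d. \<Sum>j<d. v i * X i j * v j))"

definition spectrahedron :: "nat \<Rightarrow> (nat \<Rightarrow> nat \<Rightarrow> real) set \<Rightarrow> bool" where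
  "spectrahedron d S \<longleftrightarrow>
     (\<exists>(k::nat) F b. S = {X. psd_matrix d X \<and> (\<forall>l<k. (\<Sum>i<d. \<Sum>j<d. F l i j * X i j) = b l)})"

text \<open>Complex vectors are treated as a real vector space; a projection is a real-linear map.\<close>

definition semidefinite_representable :: "'a::real_vector set \<Rightarrow> bool" where
  "semidefinite_representable S \<longleftrightarrow>
     (\<exists>d Z P. spectrahedron d Z \<and> S = (\<lambda>X. \<Sum>i<d. \<Sum>j<d. X i j *\<^sub>R P i j) ` Z)"

end

theory Submission
  imports Defs
begin

text \<open>
  All monomials of polynomials in the quadratic module have algebraic degree at most \<open>2r\<close> and harmonic
  degree at most \<open>\<rho>\<close>, so only finitely many moments matter and every family can be truncated to
  them.  The condition that the Riesz functional be nonnegative on the quadratic module says that two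
  Hermitian forms, the moment form and the localizing form, are positive semidefinite; their
  entries are linear in the moments.  Splitting moments and coefficients into real and imaginary parts
  turns this into a linear matrix inequality, which is lifted to a spectrahedron by writing each free real
  variable as a difference of two diagonal entries.

  For the inclusion, the moments of \<open>\<mu>\<close> are truncated to the same finite set, which makes them square
  summable.  The Riesz functional then integrates \<open>p(c(f))\<close>, which is nonnegative for every \<open>f\<close> in the ball
  because \<open>c\<^sub>-\<^sub>a\<close> is the conjugate of \<open>c\<^sub>a\<close>.  The integrals exist since \<open>\<mu>\<close> is finite and the Fourier
  coefficients are bounded by 1 on the ball and 1-Lipschitz in the \<open>L\<^sup>2\<close> distance.
\<close>

section \<open>Linear matrix inequalities\<close>

text \<open>Arbitrary index types let rows be labelled by sums and products, which suits
  block-diagonal matrices.\<close>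

definition psd_on :: "'j set \<Rightarrow> ('j \<Rightarrow> 'j \<Rightarrow> real) \<Rightarrow> bool" where
  "psd_on J X \<longleftrightarrow>
     (\<forall>i\<in>J. \<forall>j\<in>J. X i j = X j i) \<and> (\<forall>v. 0 \<le> (\<Sum>i\<in>J. \<Sum>j\<in>J. v i * X i j * v j))"

lemma psd_on_reindex:
  assumes h: "bij_betw h J' J" and X: "psd_on J X"
  shows "psd_on J' (\<lambda>i j. X (h i) (h j))"
  unfolding psd_on_def
proof (intro conjI ballI allI)
  show "X (h i) (h j) = X (h j) (h i)" if "i \<in> J'" "j \<in> J'" for i j
    using X h that by (auto simp: psd_on_def bij_betw_def)
  fix v
  \<comment> \<open>A vector on \<open>J'\<close> is carried to \<open>J\<close> by the inverse of
    \<open>h\<close>, so the two quadratic forms are reindexings of each other.\<close>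
  define g where "g = inv_into J' h"
  have g: "g (h i) = i" if "i \<in> J'" for i
    using h that by (auto simp: g_def bij_betw_def)
  have "(\<Sum>i\<in>J. \<Sum>j\<in>J. v (g i) * X i j * v (g j))
      = (\<Sum>i\<in>J'. \<Sum>j\<in>J'. v i * X (h i) (h j) * v j)"
    by (simp add: sum.reindex_bij_betw[OF h, symmetric] g)
  moreover have "0 \<le> (\<Sum>i\<in>J. \<Sum>j\<in>J. v (g i) * X i j * v (g j))"
    using X unfolding psd_on_def by (elim conjE) (rule allE, assumption)
  ultimately show "0 \<le> (\<Sum>i\<in>J'. \<Sum>j\<in>J'. v i * X (h i) (h j) * v j)"
    by simp
qed

lemma psd_on_lessThan: "psd_on {..<d} X \<longleftrightarrow> psd_matrix d X"
  by (auto simp: psd_on_def psd_matrix_def)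

text \<open>Enumerating \<open>J\<close> and \<open>L\<close> by initial segments of the naturals
  reduces the claim to the definition. The projected images are compared rather than the sets of
  matrices, since reindexing back and forth recovers a matrix only on the relevant indices.\<close>

lemma semidefinite_representable_psd_on:
  fixes P :: "'j \<Rightarrow> 'j \<Rightarrow> 'a::real_vector" and F :: "'l \<Rightarrow> 'j \<Rightarrow> 'j \<Rightarrow> real"
  assumes "finite J" "finite L"
  shows "semidefinite_representable ((\<lambda>X. \<Sum>i\<in>J. \<Sum>j\<in>J. X i j *\<^sub>R P i j) `
           {X. psd_on J X \<and> (\<forall>l\<in>L. (\<Sum>i\<in>J. \<Sum>j\<in>J. F l i j * X i j) = b l)})"
    (is "semidefinite_representable (?p ` ?S)")
proof -
  obtain h where h: "bij_betw h {..<card J} J"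
    using ex_bij_betw_nat_finite[OF assms(1)] by (auto simp: atLeast0LessThan)
  obtain g where g: "bij_betw g {..<card L} L"
    using ex_bij_betw_nat_finite[OF assms(2)] by (auto simp: atLeast0LessThan)
  define Z where "Z = {X. psd_matrix (card J) X \<and> (\<forall>l<card L.
     (\<Sum>i<card J. \<Sum>j<card J. F (g l) (h i) (h j) * X i j) = b (g l))}"
  define p where "p X = (\<Sum>i<card J. \<Sum>j<card J. X i j *\<^sub>R P (h i) (h j))" for X
  define h' where "h' = inv_into {..<card J} h"
  have h': "h' (h i) = i" if "i < card J" for i
    using h that by (auto simp: h'_def bij_betw_def)
  have h'0: "bij_betw h' J {..<card J}"
    using h by (auto simp: h'_def bij_betw_inv_into)
  have hh': "h (h' i) = i" if "i \<in> J" for i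
    using h that by (auto simp: h'_def bij_betw_inv_into_right)
  have gL: "g l \<in> L" if "l < card L" for l
    using g that by (auto simp: bij_betw_def)
  have gL': "(\<forall>l\<in>L. Q l) \<longleftrightarrow> (\<forall>l<card L. Q (g l))" for Q
    using g unfolding bij_betw_def by (metis imageE image_eqI lessThan_iff)
  have "?p ` ?S = p ` Z"
  proof (intro equalityI image_subsetI)
    fix X assume X: "X \<in> ?S"
    define Y where "Y = (\<lambda>i j. X (h i) (h j))"
    have "psd_matrix (card J) Y"
      using psd_on_reindex[OF h, of X] X by (simp add: psd_on_lessThan Y_def)
    moreover have "(\<Sum>i<card J. \<Sum>j<card J. F (g l) (h i) (h j) * Y i j) = b (g l)"
      if "l < card L" for l
      using X gL[OF that] by (simp add: Y_def sum.reindex_bij_betw[OF h, symmetric])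
    ultimately have "Y \<in> Z" by (simp add: Z_def)
    moreover have "?p X = p Y"
      by (simp add: p_def Y_def sum.reindex_bij_betw[OF h, symmetric])
    ultimately show "?p X \<in> p ` Z" by blast
  next
    fix Y assume Y: "Y \<in> Z"
    define X where "X = (\<lambda>i j. Y (h' i) (h' j))"
    have "psd_on J X"
      using psd_on_reindex[OF h'0, of Y] Y by (simp add: psd_on_lessThan X_def Z_def)
    moreover have "\<forall>l\<in>L. (\<Sum>i\<in>J. \<Sum>j\<in>J. F l i j * X i j) = b l"
      using Y by (simp add: gL' X_def Z_def sum.reindex_bij_betw[OF h, symmetric] h')
    ultimately have "X \<in> ?S" by simp
    moreover have "?p X = p Y"
      by (simp add: p_def X_def sum.reindex_bij_betw[OF h, symmetric] h')
    ultimately show "p Y \<in> ?p ` ?S" by (metis (mono_tags, lifting) imageI)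
  qed
  moreover have "spectrahedron (card J) Z"
    unfolding spectrahedron_def Z_def
    by (intro exI[of _ "card L"] exI[of _ "\<lambda>l i j. F (g l) (h i) (h j)"]
        exI[of _ "\<lambda>l. b (g l)"]) simp
  ultimately show ?thesis
    unfolding semidefinite_representable_def p_def
    by (intro exI[of _ "card J"] exI[of _ Z] exI[of _ "\<lambda>i j. P (h i) (h j)"] conjI)
qed

text \<open>
  The forms \<open>G t\<close> need not be symmetric, so the block-diagonal matrix carries their symmetrizations.
\<close>

lemma sum_block_diagonal:
  fixes G :: "'t \<Rightarrow> 'i \<Rightarrow> 'i \<Rightarrow> real"
  assumes "finite T" "\<And>t. t \<in> T \<Longrightarrow> finite (I t)"
  shows "(\<Sum>p\<in>Sigma T I. \<Sum>q\<in>Sigma T I. w p *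
            (if fst p = fst q then (G (fst p) (snd p) (snd q) + G (fst p) (snd q) (snd p)) / 2 else 0) * w q)
       = (\<Sum>t\<in>T. \<Sum>i\<in>I t. \<Sum>j\<in>I t. w (t, i) * w (t, j) * G t i j)"
proof -
  have Sig: "(\<Sum>p\<in>Sigma T I. f p) = (\<Sum>t\<in>T. \<Sum>i\<in>I t. f (t, i))" for f :: "_ \<Rightarrow> real"
    using assms by (simp add: sum.Sigma)
  have "(\<Sum>p\<in>Sigma T I. \<Sum>q\<in>Sigma T I. w p *
            (if fst p = fst q then (G (fst p) (snd p) (snd q) + G (fst p) (snd q) (snd p)) / 2 else 0) * w q)
     = (\<Sum>t\<in>T. \<Sum>i\<in>I t. \<Sum>s\<in>T. \<Sum>j\<in>I s. w (t, i) *
            (if t = s then (G t i j + G t j i) / 2 else 0) * w (s, j))"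
    by (simp only: Sig fst_conv snd_conv cong: if_cong)
  also have "\<dots> = (\<Sum>t\<in>T. \<Sum>i\<in>I t. \<Sum>s\<in>T. if t = s then \<Sum>j\<in>I t. w (t, i) * ((G t i j + G t j i) / 2) * w (t, j) else 0)"
    by (intro sum.cong refl) auto
  also have "\<dots> = (\<Sum>t\<in>T. \<Sum>i\<in>I t. \<Sum>j\<in>I t. w (t, i) * ((G t i j + G t j i) / 2) * w (t, j))"
    using assms(1) by (intro sum.cong refl) simp
  also have "\<dots> = (\<Sum>t\<in>T. \<Sum>i\<in>I t. \<Sum>j\<in>I t. w (t, i) * w (t, j) * G t i j)"
  proof (rule sum.cong[OF refl])
    fix t assume "t \<in> T"
    \<comment> \<open>Exchanging the two summation indices shows that a form and its transpose have
      the same values.\<close>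
    have "(\<Sum>i\<in>I t. \<Sum>j\<in>I t. w (t, i) * w (t, j) * G t j i)
        = (\<Sum>i\<in>I t. \<Sum>j\<in>I t. w (t, i) * w (t, j) * G t i j)"
      by (subst sum.swap) (simp add: mult.commute)
    moreover have "(\<Sum>i\<in>I t. \<Sum>j\<in>I t. w (t, i) * ((G t i j + G t j i) / 2) * w (t, j))
        = ((\<Sum>i\<in>I t. \<Sum>j\<in>I t. w (t, i) * w (t, j) * G t i j)
          + (\<Sum>i\<in>I t. \<Sum>j\<in>I t. w (t, i) * w (t, j) * G t j i)) / 2"
      by (simp add: sum.distrib[symmetric] sum_divide_distrib algebra_simps add_divide_distrib)
    ultimately show "(\<Sum>i\<in>I t. \<Sum>j\<in>I t. w (t, i) * ((G t i j + G t j i) / 2) * w (t, j))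
        = (\<Sum>i\<in>I t. \<Sum>j\<in>I t. w (t, i) * w (t, j) * G t i j)" by simp
  qed
  finally show ?thesis .
qed

text \<open>The forms depend linearly on free parameters \<open>z\<close>, while a spectrahedron is
  cut out by equations on the matrix alone, so \<open>z\<close> has to be stored in the matrix. It
  goes on the diagonal, indexed by \<open>Inr\<close>; the symmetrized forms are the blocks indexed
  by \<open>Inl\<close>, and equations tie the blocks to the stored parameters.\<close>

lemma semidefinite_representable_quadratic_forms:
  fixes v :: "'k \<Rightarrow> 'a::real_vector" and B :: "'t \<Rightarrow> 'k \<Rightarrow> 'i \<Rightarrow> 'i \<Rightarrow> real"
  assumes K: "finite K" and T: "finite T" and I: "\<And>t. t \<in> T \<Longrightarrow> finite (I t)"
  shows "semidefinite_representable ((\<lambda>z. \<Sum>k\<in>K. z k *\<^sub>R v k) `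
           {z. \<forall>t\<in>T. \<forall>u. 0 \<le> (\<Sum>i\<in>I t. \<Sum>j\<in>I t. u i * u j * (\<Sum>k\<in>K. z k * B t k i j))})"
    (is "semidefinite_representable (?p ` ?S)")
proof -
  define M where "M = Sigma T I"
  define J where "J = M <+> K \<times> (UNIV :: bool set)"
  define G where "G z t i j = (\<Sum>k\<in>K. z k * B t k i j)" for z t i j
  define C where "C k p q = (if fst p = fst q
      then (B (fst p) k (snd p) (snd q) + B (fst p) k (snd q) (snd p)) / 2 else 0)" for k p q
  define sg :: "bool \<Rightarrow> real" where "sg s = (if s then 1 else - 1)" for s
  \<comment> \<open>\<open>F\<close> encodes \<open>X (Inl p) (Inl q) = (\<Sum>k\<in>K. z k * C k p q)\<close>, where \<open>z k\<close> is the difference of the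
    two diagonal entries of \<open>X\<close> at \<open>Inr (k, True)\<close> and \<open>Inr (k, False)\<close>.\<close>
  define F where "F l x y = (case (x, y) of
      (Inl p, Inl q) \<Rightarrow> if p = fst l \<and> q = snd l then 1 else 0
    | (Inr a, Inr a') \<Rightarrow> if a = a' then - (sg (snd a) * C (fst a) (fst l) (snd l)) else 0
    | _ \<Rightarrow> 0)" for l and x y :: "'t \<times> 'i + 'k \<times> bool"
  define P where "P x y = (case (x, y) of
      (Inr a, Inr a') \<Rightarrow> if a = a' then sg (snd a) *\<^sub>R v (fst a) else 0
    | _ \<Rightarrow> 0)" for x y :: "'t \<times> 'i + 'k \<times> bool"
  define Y where "Y X k = X (Inr (k, True)) (Inr (k, True)) - X (Inr (k, False)) (Inr (k, False))"
    for X :: "'t \<times> 'i + 'k \<times> bool \<Rightarrow> 't \<times> 'i + 'k \<times> bool \<Rightarrow> real" and k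
  have finM: "finite M" using T I by (auto simp: M_def)
  have finKb: "finite (K \<times> (UNIV :: bool set))" using K by simp
  have finJ: "finite J" using finM finKb by (auto simp: J_def)
  have sumJ: "sum f J = (\<Sum>p\<in>M. f (Inl p)) + (\<Sum>a\<in>K \<times> UNIV. f (Inr a))" for f :: "_ \<Rightarrow> 'b::comm_monoid_add"
    using sum.Plus[OF finM finKb, of f] by (simp add: J_def)
  have sumKb: "(\<Sum>a\<in>K \<times> UNIV. f a) = (\<Sum>k\<in>K. f (k, True) + f (k, False))" for f :: "_ \<Rightarrow> 'b::comm_monoid_add"
    using sum.cartesian_product[of "\<lambda>k s. f (k, s)" "UNIV :: bool set" K]
    by (simp add: UNIV_bool add.commute)
  have GC: "(\<Sum>k\<in>K. z k * C k p q) = (if fst p = fst q then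
      (G z (fst p) (snd p) (snd q) + G z (fst p) (snd q) (snd p)) / 2 else 0)" for z p q
    by (simp add: C_def G_def sum_distrib_left sum_divide_distrib sum.distrib[symmetric] algebra_simps add_divide_distrib)
  have blocks: "(\<Sum>p\<in>M. \<Sum>q\<in>M. w p * (\<Sum>k\<in>K. z k * C k p q) * w q)
      = (\<Sum>t\<in>T. \<Sum>i\<in>I t. \<Sum>j\<in>I t. w (t, i) * w (t, j) * G z t i j)" for w z
    unfolding M_def GC by (rule sum_block_diagonal[OF T I])
  have constraint: "(\<Sum>x\<in>J. \<Sum>y\<in>J. F (p, q) x y * X x y) = X (Inl p) (Inl q) - (\<Sum>k\<in>K. Y X k * C k p q)"
    if pq: "p \<in> M" "q \<in> M" for p q X
  proof -
    have 1: "(\<Sum>p'\<in>M. \<Sum>q'\<in>M. F (p, q) (Inl p') (Inl q') * X (Inl p') (Inl q')) = X (Inl p) (Inl q)"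
    proof -
      have "(\<Sum>p'\<in>M. \<Sum>q'\<in>M. F (p, q) (Inl p') (Inl q') * X (Inl p') (Inl q'))
          = (\<Sum>p'\<in>M. if p' = p then \<Sum>q'\<in>M. if q' = q then X (Inl p) (Inl q) else 0 else 0)"
        by (intro sum.cong refl) (auto simp: F_def intro!: sum.cong)
      then show ?thesis using pq finM by simp
    qed
    have 2: "(\<Sum>a\<in>K \<times> UNIV. \<Sum>a'\<in>K \<times> UNIV. F (p, q) (Inr a) (Inr a') * X (Inr a) (Inr a'))
        = (\<Sum>a\<in>K \<times> UNIV. - (sg (snd a) * C (fst a) p q) * X (Inr a) (Inr a))"
    proof (intro sum.cong refl)
      fix a assume a: "a \<in> K \<times> (UNIV :: bool set)"
      have "(\<Sum>a'\<in>K \<times> UNIV. F (p, q) (Inr a) (Inr a') * X (Inr a) (Inr a'))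
          = (\<Sum>a'\<in>K \<times> UNIV. if a' = a then - (sg (snd a) * C (fst a) p q) * X (Inr a) (Inr a) else 0)"
        by (intro sum.cong refl) (auto simp: F_def)
      then show "(\<Sum>a'\<in>K \<times> UNIV. F (p, q) (Inr a) (Inr a') * X (Inr a) (Inr a'))
          = - (sg (snd a) * C (fst a) p q) * X (Inr a) (Inr a)"
        using a finKb by simp
    qed
    have 3: "(\<Sum>a\<in>K \<times> UNIV. - (sg (snd a) * C (fst a) p q) * X (Inr a) (Inr a))
        = - (\<Sum>k\<in>K. Y X k * C k p q)"
      by (rule trans[OF sumKb]) (simp add: sg_def Y_def sum_negf sum_subtractf sum.distrib algebra_simps)
    have 4: "F l (Inl a) (Inr b) = 0" "F l (Inr b) (Inl a) = 0" for l a b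
      by (simp_all add: F_def)
    show ?thesis
      by (simp add: sumJ 4 1 trans[OF 2 3])
  qed
  have proj: "(\<Sum>x\<in>J. \<Sum>y\<in>J. X x y *\<^sub>R P x y) = ?p (Y X)" for X
  proof -
    have 1: "(\<Sum>a\<in>K \<times> UNIV. \<Sum>a'\<in>K \<times> UNIV. X (Inr a) (Inr a') *\<^sub>R P (Inr a) (Inr a'))
        = (\<Sum>a\<in>K \<times> UNIV. X (Inr a) (Inr a) *\<^sub>R sg (snd a) *\<^sub>R v (fst a))"
    proof (intro sum.cong refl)
      fix a assume a: "a \<in> K \<times> (UNIV :: bool set)"
      have "(\<Sum>a'\<in>K \<times> UNIV. X (Inr a) (Inr a') *\<^sub>R P (Inr a) (Inr a'))
          = (\<Sum>a'\<in>K \<times> UNIV. if a' = a then X (Inr a) (Inr a) *\<^sub>R sg (snd a) *\<^sub>R v (fst a) else 0)"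
        by (intro sum.cong refl) (auto simp: P_def)
      then show "(\<Sum>a'\<in>K \<times> UNIV. X (Inr a) (Inr a') *\<^sub>R P (Inr a) (Inr a'))
          = X (Inr a) (Inr a) *\<^sub>R sg (snd a) *\<^sub>R v (fst a)"
        using a finKb by simp
    qed
    have 2: "P (Inl a) y = 0" "P x (Inl a) = 0" for a x y
      by (simp_all add: P_def split: sum.split)
    show ?thesis
      by (simp add: sumJ 1 2) (simp add: sumKb sg_def Y_def algebra_simps)
  qed
  have "?p ` ?S = (\<lambda>X. \<Sum>x\<in>J. \<Sum>y\<in>J. X x y *\<^sub>R P x y) `
      {X. psd_on J X \<and> (\<forall>l\<in>M \<times> M. (\<Sum>x\<in>J. \<Sum>y\<in>J. F l x y * X x y) = 0)}"
    (is "_ = _ ` ?Z")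
  proof (intro equalityI image_subsetI)
    fix z assume z: "z \<in> ?S"
    \<comment> \<open>Positive and negative parts of \<open>z\<close>: diagonal entries of a
      positive semidefinite matrix are nonnegative, and their differences give back
      \<open>z\<close>.\<close>
    define N where "N a = (if snd a then max (z (fst a)) 0 else max (- z (fst a)) 0)" for a :: "'k \<times> bool"
    define X where "X x y = (case (x, y) of
        (Inl p, Inl q) \<Rightarrow> \<Sum>k\<in>K. z k * C k p q
      | (Inr a, Inr a') \<Rightarrow> if a = a' then N a else 0
      | _ \<Rightarrow> 0)" for x y :: "'t \<times> 'i + 'k \<times> bool"
    have YX: "Y X = z" by (auto simp: Y_def X_def N_def)
    have "C k p q = C k q p" for k p q
      by (auto simp: C_def add.commute)
    then have sym: "X x y = X y x" for x y
      by (auto simp: X_def split: sum.split)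
    have "0 \<le> (\<Sum>x\<in>J. \<Sum>y\<in>J. w x * X x y * w y)" for w
    proof -
      have "(\<Sum>x\<in>J. \<Sum>y\<in>J. w x * X x y * w y)
          = (\<Sum>p\<in>M. \<Sum>q\<in>M. w (Inl p) * (\<Sum>k\<in>K. z k * C k p q) * w (Inl q))
            + (\<Sum>a\<in>K \<times> UNIV. \<Sum>a'\<in>K \<times> UNIV. w (Inr a) * (if a = a' then N a else 0) * w (Inr a'))"
        by (simp add: sumJ X_def)
      also have "0 \<le> \<dots>"
      proof (intro add_nonneg_nonneg)
        show "0 \<le> (\<Sum>p\<in>M. \<Sum>q\<in>M. w (Inl p) * (\<Sum>k\<in>K. z k * C k p q) * w (Inl q))"
          unfolding blocks[of "\<lambda>p. w (Inl p)"]
        proof (rule sum_nonneg)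
          fix t assume t: "t \<in> T"
          have "\<forall>u. 0 \<le> (\<Sum>i\<in>I t. \<Sum>j\<in>I t. u i * u j * G z t i j)"
            using z t unfolding G_def by blast
          from this[rule_format, of "\<lambda>i. w (Inl (t, i))"]
          show "0 \<le> (\<Sum>i\<in>I t. \<Sum>j\<in>I t. w (Inl (t, i)) * w (Inl (t, j)) * G z t i j)" .
        qed
        have "0 \<le> N a * (w (Inr a))\<^sup>2" for a
          by (simp add: N_def)
        then have "0 \<le> w (Inr a) * (if a = a' then N a else 0) * w (Inr a')" for a a'
          by (simp add: power2_eq_square algebra_simps)
        then show "0 \<le> (\<Sum>a\<in>K \<times> UNIV. \<Sum>a'\<in>K \<times> UNIV. w (Inr a) * (if a = a' then N a else 0) * w (Inr a'))"
          by (intro sum_nonneg)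
      qed
      finally show ?thesis .
    qed
    with sym have "psd_on J X" by (auto simp: psd_on_def)
    moreover have "\<forall>l\<in>M \<times> M. (\<Sum>x\<in>J. \<Sum>y\<in>J. F l x y * X x y) = 0"
      by (auto simp: constraint YX) (simp add: X_def)
    ultimately have "X \<in> ?Z" by simp
    moreover have "?p z = (\<Sum>x\<in>J. \<Sum>y\<in>J. X x y *\<^sub>R P x y)"
      by (simp add: proj YX)
    ultimately show "?p z \<in> (\<lambda>X. \<Sum>x\<in>J. \<Sum>y\<in>J. X x y *\<^sub>R P x y) ` ?Z"
      by auto
  next
    fix X assume X: "X \<in> ?Z"
    have XC: "X (Inl p) (Inl q) = (\<Sum>k\<in>K. Y X k * C k p q)" if "p \<in> M" "q \<in> M" for p q
    proof -
      have "(\<Sum>x\<in>J. \<Sum>y\<in>J. F (p, q) x y * X x y) = 0"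
        using X that by blast
      then show ?thesis using constraint[OF that] by simp
    qed
    have "0 \<le> (\<Sum>i\<in>I t. \<Sum>j\<in>I t. u i * u j * G (Y X) t i j)" if t: "t \<in> T" for t u
    proof -
      \<comment> \<open>Testing \<open>X\<close> with a vector supported on block \<open>t\<close>
        isolates the form \<open>t\<close>. Its extension \<open>w'\<close> vanishes on the diagonal
        part, so the unconstrained entries of \<open>X\<close> do not contribute.\<close>
      define w where "w p = (if fst p = t then u (snd p) else 0)" for p :: "'t \<times> 'i"
      define w' where "w' x = (case x of Inl p \<Rightarrow> w p | Inr (_ :: 'k \<times> bool) \<Rightarrow> 0)" for x
      have "\<forall>v. 0 \<le> (\<Sum>x\<in>J. \<Sum>y\<in>J. v x * X x y * v y)"
        using X by (simp add: psd_on_def)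
      then have "0 \<le> (\<Sum>x\<in>J. \<Sum>y\<in>J. w' x * X x y * w' y)" by blast
      also have "\<dots> = (\<Sum>p\<in>M. \<Sum>q\<in>M. w p * X (Inl p) (Inl q) * w q)"
        by (simp add: sumJ w'_def)
      also have "\<dots> = (\<Sum>p\<in>M. \<Sum>q\<in>M. w p * (\<Sum>k\<in>K. Y X k * C k p q) * w q)"
        by (simp add: XC)
      also have "\<dots> = (\<Sum>s\<in>T. \<Sum>i\<in>I s. \<Sum>j\<in>I s. w (s, i) * w (s, j) * G (Y X) s i j)"
        by (rule blocks)
      also have "\<dots> = (\<Sum>s\<in>T. if s = t then \<Sum>i\<in>I t. \<Sum>j\<in>I t. u i * u j * G (Y X) t i j else 0)"
        by (intro sum.cong refl) (auto simp: w_def)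
      also have "\<dots> = (\<Sum>i\<in>I t. \<Sum>j\<in>I t. u i * u j * G (Y X) t i j)"
        using t T by simp
      finally show ?thesis .
    qed
    then have "Y X \<in> ?S" by (simp add: G_def)
    then show "(\<Sum>x\<in>J. \<Sum>y\<in>J. X x y *\<^sub>R P x y) \<in> ?p ` ?S"
      unfolding proj by blast
  qed
  then show ?thesis
    using semidefinite_representable_psd_on[OF finJ, of "M \<times> M"  P F "\<lambda>_. 0"] finM by simp
qed

section \<open>The outer cone as a linear matrix inequality\<close>

lemma riesz_eq_sum:
  assumes "finite X" "Poly_Mapping.keys p \<subseteq> X"
  shows "riesz y p = (\<Sum>M\<in>X. Poly_Mapping.lookup p M * y M)"
  unfolding riesz_def using assms
  by (intro sum.mono_neutral_left) (auto simp: in_keys_iff)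

lemma riesz_cong:
  assumes "\<And>M. M \<in> Poly_Mapping.keys p \<Longrightarrow> y M = y' M"
  shows "riesz y p = riesz y' p"
  using assms by (simp add: riesz_def)

lemma riesz_zero [simp]: "riesz y 0 = 0"
  by (simp add: riesz_def)

lemma riesz_single [simp]: "riesz y (Poly_Mapping.single M c) = c * y M"
  by (simp add: riesz_def)

lemma riesz_one [simp]: "riesz y 1 = y {#}"
  using riesz_single[of y 0 1] by simp

lemma riesz_add: "riesz y (p + q) = riesz y p + riesz y q"
proof -
  have "finite (Poly_Mapping.keys p \<union> Poly_Mapping.keys q)" by simp
  from riesz_eq_sum[OF this] show ?thesis
    using keys_add[of p q] by (simp add: lookup_add sum.distrib distrib_right)
qed

lemma riesz_sum: "riesz y (\<Sum>i\<in>I. p i) = (\<Sum>i\<in>I. riesz y (p i))"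
  by (induction I rule: infinite_finite_induct) (auto simp: riesz_add)

lemma riesz_minus: "riesz y (p - q) = riesz y p - riesz y q"
  using riesz_add[of y "p - q" q] by simp

text \<open>Linearity in the moments, complementing linearity in the polynomial; it makes the
  entries of the moment and localizing forms linear in the parameters.\<close>

lemma riesz_linear_combination:
  "riesz (\<lambda>M. \<Sum>k\<in>K. z k * e k M) p = (\<Sum>k\<in>K. z k * riesz (e k) p)"
  unfolding riesz_def sum_distrib_left by (subst sum.swap) (simp add: mult.left_commute)

lemma poly_mapping_sum_single:
  "p = (\<Sum>M\<in>Poly_Mapping.keys p. Poly_Mapping.single M (Poly_Mapping.lookup p M))"
  by (rule poly_mapping_eqI)
    (auto simp: lookup_sum lookup_single when_def in_keys_iff)

text \<open>For a multiplicative family the Riesz functional is evaluation at a point, hence a ring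
  homomorphism. The families of interest are the monomials in the Fourier coefficients of one
  function.\<close>

lemma riesz_mult:
  assumes "\<And>M N. y (M + N) = y M * y N"
  shows "riesz y (p * q) = riesz y p * riesz y q"
proof -
  have "p * q = (\<Sum>M\<in>Poly_Mapping.keys p. \<Sum>N\<in>Poly_Mapping.keys q.
      Poly_Mapping.single (M + N) (Poly_Mapping.lookup p M * Poly_Mapping.lookup q N))"
    by (subst poly_mapping_sum_single[of p], subst poly_mapping_sum_single[of q])
      (simp add: sum_product mult_single)
  then show ?thesis
    by (simp only: riesz_sum riesz_single assms)
      (simp add: riesz_def[of y p] riesz_def[of y q] sum_product mult_ac)
qed

lemma riesz_scale: "riesz y (Poly_Mapping.single 0 c * p) = c * riesz y p"
proof -
  have "Poly_Mapping.single 0 c * p = (\<Sum>M\<in>Poly_Mapping.keys p.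
      Poly_Mapping.single M (c * Poly_Mapping.lookup p M))"
    by (subst poly_mapping_sum_single[of p]) (simp add: sum_distrib_left mult_single)
  then show ?thesis
    by (simp only: riesz_sum riesz_single) (simp add: riesz_def sum_distrib_left mult.assoc)
qed

text \<open>Negating all indices is an involution on multisets, so a single term of the defining sum
  contributes.\<close>

lemma lookup_poly_conj:
  "Poly_Mapping.lookup (poly_conj q) M = cnj (Poly_Mapping.lookup q (image_mset uminus M))"
proof -
  have inv: "image_mset uminus N = M \<longleftrightarrow> N = image_mset uminus M" for N
    by (auto simp: multiset.map_comp o_def)
  show ?thesis
    by (simp add: poly_conj_def lookup_sum lookup_single when_def inv in_keys_iff)
qed

lemma poly_conj_sum: "poly_conj (\<Sum>i\<in>I. p i) = (\<Sum>i\<in>I. poly_conj (p i))"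
  by (rule poly_mapping_eqI) (simp add: lookup_poly_conj lookup_sum)

lemma poly_conj_single:
  "poly_conj (Poly_Mapping.single M c) = Poly_Mapping.single (image_mset uminus M) (cnj c)"
  by (cases "c = 0") (auto simp: poly_conj_def)

lemma keys_poly_conj: "Poly_Mapping.keys (poly_conj q) = image_mset uminus ` Poly_Mapping.keys q"
proof -
  have inv: "image_mset uminus (image_mset uminus M) = M" for M :: "(int ^ 'n) multiset"
    by (simp add: multiset.map_comp o_def)
  show ?thesis
  proof (intro equalityI subsetI)
    fix M assume "M \<in> Poly_Mapping.keys (poly_conj q)"
    then have "image_mset uminus M \<in> Poly_Mapping.keys q"
      by (simp add: in_keys_iff lookup_poly_conj)
    then show "M \<in> image_mset uminus ` Poly_Mapping.keys q"
      by (metis image_eqI inv)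
  qed (auto simp: in_keys_iff lookup_poly_conj inv)
qed

section \<open>Finiteness and degree bounds for monomials\<close>

definition bounded_indices :: "int \<Rightarrow> int \<Rightarrow> (int ^ 'n) multiset set" where
  "bounded_indices r \<rho> = {M. int (size M) \<le> r \<and> harmonic_degree M \<le> \<rho>}"

lemma harmonic_degree_le_iff:
  "harmonic_degree M \<le> \<rho> \<longleftrightarrow> 0 \<le> \<rho> \<and> (\<forall>a\<in>#M. index_degree a \<le> \<rho>)"
  by (auto simp: harmonic_degree_def)

lemma index_degree_le_iff: "index_degree a \<le> \<rho> \<longleftrightarrow> (\<forall>i. \<bar>a $ i\<bar> \<le> \<rho>)"
  by (auto simp: index_degree_def)

lemma index_degree_uminus [simp]: "index_degree (- a) = index_degree a"
  by (simp add: index_degree_def)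

lemma finite_index_degree_le: "finite {a :: int ^ 'n. index_degree a \<le> \<rho>}"
proof (rule inj_on_finite)
  show "inj_on vec_nth {a :: int ^ 'n. index_degree a \<le> \<rho>}"
    by (auto intro!: inj_onI simp: vec_nth_inject)
  show "vec_nth ` {a :: int ^ 'n. index_degree a \<le> \<rho>} \<subseteq> (UNIV \<rightarrow>\<^sub>E {- \<rho>..\<rho>})"
    by (auto simp: index_degree_le_iff abs_le_iff) (metis minus_le_iff)
  show "finite ((UNIV :: 'n set) \<rightarrow>\<^sub>E {- \<rho>..\<rho>})"
    by (intro finite_PiE) auto
qed

text \<open>Each such multiset is the content of a list of bounded length over the finitely many
  indices of degree at most \<open>\<rho>\<close>.\<close>

lemma finite_bounded_indices: "finite (bounded_indices r \<rho> :: (int ^ 'n) multiset set)"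
proof (rule finite_subset)
  show "bounded_indices r \<rho> \<subseteq> mset ` {xs :: (int ^ 'n) list. set xs \<subseteq> {a. index_degree a \<le> \<rho>} \<and> length xs \<le> nat r}"
  proof
    fix M :: "(int ^ 'n) multiset"
    assume M: "M \<in> bounded_indices r \<rho>"
    obtain xs where "M = mset xs" by (metis ex_mset)
    with M show "M \<in> mset ` {xs. set xs \<subseteq> {a. index_degree a \<le> \<rho>} \<and> length xs \<le> nat r}"
      by (auto simp: bounded_indices_def harmonic_degree_le_iff)
  qed
  show "finite (mset ` {xs :: (int ^ 'n) list. set xs \<subseteq> {a. index_degree a \<le> \<rho>} \<and> length xs \<le> nat r})"
    by (intro finite_imageI finite_lists_length_le finite_index_degree_le)
qed

lemma cpoly_bounded_altdef: "cpoly_bounded r \<rho> = {p. Poly_Mapping.keys p \<subseteq> bounded_indices r \<rho>}"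
  by (auto simp: cpoly_bounded_def bounded_indices_def)

lemma cpoly_bounded_add:
  "p \<in> cpoly_bounded r \<rho> \<Longrightarrow> q \<in> cpoly_bounded r \<rho> \<Longrightarrow> p + q \<in> cpoly_bounded r \<rho>"
  using keys_add[of p q] by (auto simp: cpoly_bounded_altdef)

lemma cpoly_bounded_minus:
  "p \<in> cpoly_bounded r \<rho> \<Longrightarrow> q \<in> cpoly_bounded r \<rho> \<Longrightarrow> p - q \<in> cpoly_bounded r \<rho>"
  using keys_diff[of p q] by (auto simp: cpoly_bounded_altdef)

lemma zero_cpoly_bounded: "0 \<in> cpoly_bounded r \<rho>"
  by (simp add: cpoly_bounded_def)

lemma cpoly_bounded_sum:
  "(\<And>i. i \<in> I \<Longrightarrow> p i \<in> cpoly_bounded r \<rho>) \<Longrightarrow> (\<Sum>i\<in>I. p i) \<in> cpoly_bounded r \<rho>"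
  by (induction I rule: infinite_finite_induct) (auto intro: cpoly_bounded_add zero_cpoly_bounded)

lemma cpoly_bounded_mult:
  assumes "p \<in> cpoly_bounded r \<rho>" "q \<in> cpoly_bounded s \<rho>"
  shows "p * q \<in> cpoly_bounded (r + s) \<rho>"
  using keys_mult[of p q] assms
  by (fastforce simp: cpoly_bounded_altdef bounded_indices_def harmonic_degree_le_iff)

lemma cpoly_bounded_poly_conj: "p \<in> cpoly_bounded r \<rho> \<Longrightarrow> poly_conj p \<in> cpoly_bounded r \<rho>"
  by (auto simp: cpoly_bounded_def keys_poly_conj harmonic_degree_le_iff)

lemma one_cpoly_bounded: "0 \<le> r \<Longrightarrow> 0 \<le> \<rho> \<Longrightarrow> 1 \<in> cpoly_bounded r \<rho>"
  by (auto simp: cpoly_bounded_def harmonic_degree_le_iff)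

lemma ball_poly_cpoly_bounded:
  assumes "0 \<le> \<rho>"
  shows "ball_poly m \<rho> \<in> cpoly_bounded 2 \<rho>"
  unfolding ball_poly_def using assms
  by (intro cpoly_bounded_minus cpoly_bounded_sum one_cpoly_bounded)
    (auto simp: cpoly_bounded_def harmonic_degree_le_iff split: if_splits)

lemma sos_cone_cpoly_bounded: "s \<in> sos_cone r \<rho> \<Longrightarrow> s \<in> cpoly_bounded (2 * r) \<rho>"
  using cpoly_bounded_mult[OF cpoly_bounded_poly_conj, of _ r \<rho> _ r]
  by (auto simp: sos_cone_def intro!: cpoly_bounded_sum)

text \<open>The multiplier degree \<open>r - 1\<close> compensates for the degree 2 of
  \<open>ball_poly\<close>, so both summands stay within degree \<open>2 * r\<close>. This is what
  permits truncating the moments to \<open>bounded_indices (2 * r) \<rho>\<close>.\<close>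

lemma quad_module_cpoly_bounded:
  assumes "0 \<le> \<rho>" "p \<in> quad_module m r \<rho>"
  shows "p \<in> cpoly_bounded (2 * r) \<rho>"
proof -
  obtain s0 s1 where p: "p = s0 + s1 * ball_poly m \<rho>"
    and s: "s0 \<in> sos_cone r \<rho>" "s1 \<in> sos_cone (r - 1) \<rho>"
    using assms(2) by (auto simp: quad_module_def)
  have "s1 * ball_poly m \<rho> \<in> cpoly_bounded (2 * (r - 1) + 2) \<rho>"
    using s(2) assms(1) by (intro cpoly_bounded_mult sos_cone_cpoly_bounded ball_poly_cpoly_bounded)
  then show ?thesis
    unfolding p using sos_cone_cpoly_bounded[OF s(1)] by (intro cpoly_bounded_add) simp_all
qed

section \<open>Reduction of the quadratic module to its generating squares\<close>

lemma sos_cone_square: "q \<in> cpoly_bounded r \<rho> \<Longrightarrow> poly_conj q * q \<in> sos_cone r \<rho>"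
  unfolding sos_cone_def by (auto intro!: exI[of _ "1::nat"] exI[of _ "\<lambda>_. q"])

lemma zero_sos_cone: "0 \<in> sos_cone r \<rho>"
  unfolding sos_cone_def by (auto intro!: exI[of _ "0::nat"])

lemma nonneg_Reals_sum: "(\<And>i. i \<in> I \<Longrightarrow> f i \<in> \<real>\<^sub>\<ge>\<^sub>0) \<Longrightarrow> (\<Sum>i\<in>I. f i :: complex) \<in> \<real>\<^sub>\<ge>\<^sub>0"
  by (induction I rule: infinite_finite_induct) auto

text \<open>Elements of the quadratic module are finite sums of squares and of squares times
  \<open>ball_poly\<close>, and the nonnegative reals are closed under addition. The two conditions
  are positivity of the moment form and of the localizing form.\<close>

lemma riesz_quad_module_nonneg_iff:
  fixes y :: "(int ^ 'n) multiset \<Rightarrow> complex"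
  shows "(\<forall>p\<in>quad_module m r \<rho>. riesz y p \<in> \<real>\<^sub>\<ge>\<^sub>0) \<longleftrightarrow>
     (\<forall>q\<in>cpoly_bounded r \<rho>. riesz y (poly_conj q * q) \<in> \<real>\<^sub>\<ge>\<^sub>0) \<and>
     (\<forall>q\<in>cpoly_bounded (r - 1) \<rho>. riesz y (poly_conj q * q * ball_poly m \<rho>) \<in> \<real>\<^sub>\<ge>\<^sub>0)"
    (is "?L \<longleftrightarrow> ?R1 \<and> ?R2")
proof (intro iffI conjI ballI)
  fix q :: "'n cpoly" assume L: ?L and q: "q \<in> cpoly_bounded r \<rho>"
  have "poly_conj q * q + 0 * ball_poly m \<rho> \<in> quad_module m r \<rho>"
    unfolding quad_module_def using sos_cone_square[OF q] zero_sos_cone by blast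
  with L show "riesz y (poly_conj q * q) \<in> \<real>\<^sub>\<ge>\<^sub>0" by force
next
  fix q :: "'n cpoly" assume L: ?L and q: "q \<in> cpoly_bounded (r - 1) \<rho>"
  have "0 + poly_conj q * q * ball_poly m \<rho> \<in> quad_module m r \<rho>"
    unfolding quad_module_def using sos_cone_square[OF q] zero_sos_cone by blast
  with L show "riesz y (poly_conj q * q * ball_poly m \<rho>) \<in> \<real>\<^sub>\<ge>\<^sub>0" by force
next
  fix p :: "'n cpoly" assume R: "?R1 \<and> ?R2" and "p \<in> quad_module m r \<rho>"
  then show "riesz y p \<in> \<real>\<^sub>\<ge>\<^sub>0"
    by (fastforce simp: quad_module_def sos_cone_def riesz_add riesz_sum sum_distrib_right
        intro!: nonneg_Reals_add_I nonneg_Reals_sum)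
qed

section \<open>Real coordinates for polynomials and moments\<close>

definition basis_unit :: "bool \<Rightarrow> complex" where
  "basis_unit b = (if b then \<i> else 1)"

definition basis_poly :: "(int ^ 'n) multiset \<times> bool \<Rightarrow> ('n::finite) cpoly" where
  "basis_poly i = Poly_Mapping.single (fst i) (basis_unit (snd i))"

text \<open>Assembles a complex number from its real coordinates along 1 and \<open>\<i>\<close>; it
  serves both for the coefficients of polynomials and for the moments.\<close>

lemma sum_basis_unit:
  assumes "finite X"
  shows "(\<Sum>i\<in>X \<times> UNIV. of_real (u i) * (if M = fst i then basis_unit (snd i) else 0))
      = (if M \<in> X then Complex (u (M, False)) (u (M, True)) else 0)"
proof -
  have "(\<Sum>i\<in>X \<times> UNIV. of_real (u i) * (if M = fst i then basis_unit (snd i) else 0))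
      = (\<Sum>N\<in>X. \<Sum>b\<in>UNIV. of_real (u (N, b)) * (if M = N then basis_unit b else 0))"
    by (simp add: sum.cartesian_product split_def)
  also have "\<dots> = (\<Sum>N\<in>X. if M = N then Complex (u (M, False)) (u (M, True)) else 0)"
    by (intro sum.cong refl) (auto simp: UNIV_bool basis_unit_def complex_eq_iff)
  also have "\<dots> = (if M \<in> X then Complex (u (M, False)) (u (M, True)) else 0)"
    using assms by simp
  finally show ?thesis .
qed

text \<open>With two real coordinates per monomial, the condition on all complex \<open>q\<close>
  becomes a condition on all real vectors \<open>u\<close>, as a real linear matrix inequality
  requires.\<close>

lemma cpoly_bounded_eq_span:
  "(cpoly_bounded r \<rho> :: ('n::finite) cpoly set) =
     range (\<lambda>u. \<Sum>i\<in>bounded_indices r \<rho> \<times> UNIV. Poly_Mapping.single 0 (of_real (u i)) * basis_poly i)"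
    (is "_ = range ?q")
proof -
  have lookup: "Poly_Mapping.lookup (?q u) M
      = (if M \<in> bounded_indices r \<rho> then Complex (u (M, False)) (u (M, True)) else 0)" for u M
  proof -
    have "Poly_Mapping.lookup (?q u) M = (\<Sum>i\<in>bounded_indices r \<rho> \<times> UNIV.
        of_real (u i) * (if M = fst i then basis_unit (snd i) else 0))"
      by (auto simp: lookup_sum basis_poly_def mult_single lookup_single when_def intro!: sum.cong)
    then show ?thesis by (simp only: sum_basis_unit[OF finite_bounded_indices])
  qed
  show ?thesis
  proof (intro equalityI subsetI)
    fix p :: "'n cpoly" assume p: "p \<in> cpoly_bounded r \<rho>"
    have "p = ?q (\<lambda>(M, b). if b then Im (Poly_Mapping.lookup p M) else Re (Poly_Mapping.lookup p M))"
      using p by (intro poly_mapping_eqI) (auto simp: lookup cpoly_bounded_altdef in_keys_iff)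
    then show "p \<in> range ?q" by blast
  next
    fix p :: "'n cpoly" assume "p \<in> range ?q"
    then obtain u where "p = ?q u" by blast
    then show "p \<in> cpoly_bounded r \<rho>"
      by (auto simp: cpoly_bounded_altdef in_keys_iff lookup split: if_splits)
  qed
qed

text \<open>Gram expansion of the Riesz functional on squares: real scalars are fixed by conjugation
  and come out as \<open>u i * u j\<close>. The factor \<open>g\<close> is 1 for the moment form and
  \<open>ball_poly\<close> for the localizing form.\<close>

lemma riesz_square_span:
  fixes g :: "('n::finite) cpoly"
  shows "riesz y (poly_conj (\<Sum>i\<in>X. Poly_Mapping.single 0 (of_real (u i)) * basis_poly i)
        * (\<Sum>j\<in>X. Poly_Mapping.single 0 (of_real (u j)) * basis_poly j) * g)
    = (\<Sum>i\<in>X. \<Sum>j\<in>X. of_real (u i * u j) * riesz y (poly_conj (basis_poly i) * basis_poly j * g))"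
proof -
  have conj: "poly_conj (Poly_Mapping.single 0 (of_real (u i)) * basis_poly i)
      = Poly_Mapping.single 0 (of_real (u i)) * poly_conj (basis_poly i)" for i :: "(int ^ 'n) multiset \<times> bool"
    by (simp add: basis_poly_def mult_single poly_conj_single)
  have "Poly_Mapping.single 0 (of_real (u i)) * poly_conj (basis_poly i)
        * (Poly_Mapping.single 0 (of_real (u j)) * basis_poly j) * g
      = Poly_Mapping.single 0 (of_real (u i * u j)) * (poly_conj (basis_poly i) * basis_poly j * g)"
    for i j
  proof -
    have "Poly_Mapping.single 0 (of_real (u i * u j)) = (Poly_Mapping.single 0 (of_real (u i))
        * Poly_Mapping.single 0 (of_real (u j)) :: 'n cpoly)"
      by (simp add: mult_single)
    then show ?thesis by (simp add: mult_ac)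
  qed
  moreover have "(\<Sum>i\<in>X. a i) * (\<Sum>j\<in>X. b j) * g = (\<Sum>i\<in>X. \<Sum>j\<in>X. a i * b j * g)"
    for a b :: "(int ^ 'n) multiset \<times> bool \<Rightarrow> 'n cpoly"
    by (subst sum_product) (simp only: sum_distrib_right)
  ultimately show ?thesis
    by (simp only: poly_conj_sum conj riesz_sum riesz_scale)
qed

text \<open>The multipliers \<open>\<i>\<close> and \<open>- \<i>\<close> give the two inequalities
  that force the imaginary part to vanish. Membership is thus expressed by inequalities only, the
  shape handled by \<open>semidefinite_representable_quadratic_forms\<close>.\<close>

lemma nonneg_Reals_iff_Re:
  "w \<in> \<real>\<^sub>\<ge>\<^sub>0 \<longleftrightarrow> (\<forall>c\<in>{1, \<i>, - \<i>}. 0 \<le> Re (c * w))"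
  by (auto simp: complex_nonneg_Reals_iff)

lemma semidefinite_representable_outer_cone:
  fixes A :: "(int ^ 'n) multiset ^ 'k"
  assumes \<rho>: "0 \<le> \<rho>" and A: "\<And>i. A $ i \<in> bounded_indices (2 * r) \<rho>"
  shows "semidefinite_representable (outer_cone m r \<rho> A)"
proof -
  define K where "K = (bounded_indices (2 * r) \<rho> :: (int ^ 'n) multiset set) \<times> (UNIV :: bool set)"
  define e where "e k M = (if M = fst k then basis_unit (snd k) else 0)"
    for k :: "(int ^ 'n) multiset \<times> bool" and M
  \<comment> \<open>The truncated family whose moments have the real and imaginary parts listed in
    \<open>z\<close>, and which is 0 elsewhere.\<close>
  define Y where "Y z = (\<lambda>M. \<Sum>k\<in>K. of_real (z k) * e k M)"
    for z :: "(int ^ 'n) multiset \<times> bool \<Rightarrow> real"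
  \<comment> \<open>\<open>fst t\<close> is one of the multipliers of \<open>nonneg_Reals_iff_Re\<close>; \<open>snd t\<close> selects the moment form
    (true) or the localizing form (false).\<close>
  define I where "I t = (bounded_indices (if snd t then r else r - 1) \<rho> :: (int ^ 'n) multiset set) \<times> (UNIV :: bool set)"
    for t :: "complex \<times> bool"
  define g :: "bool \<Rightarrow> 'n cpoly" where "g s = (if s then 1 else ball_poly m \<rho>)" for s
  \<comment> \<open>The coefficient of the parameter \<open>z k\<close> in entry
    \<open>(i, j)\<close> of the form \<open>t\<close>.\<close>
  define B where "B t k i j = Re (fst t * riesz (e k) (poly_conj (basis_poly i) * basis_poly j * g (snd t)))"
    for t k i j
  define T where "T = {1, \<i>, - \<i>} \<times> (UNIV :: bool set)"
  define v :: "_ \<Rightarrow> complex ^ 'k" where "v k = (\<chi> i. e k (A $ i))" for k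
  have finK: "finite K" by (simp add: K_def finite_bounded_indices)
  have Y: "Y z M = (if M \<in> bounded_indices (2 * r) \<rho> then Complex (z (M, False)) (z (M, True)) else 0)" for z M
    unfolding Y_def e_def K_def by (rule sum_basis_unit[OF finite_bounded_indices])
  have psd_iff: "(\<forall>p\<in>quad_module m r \<rho>. riesz (Y z) p \<in> \<real>\<^sub>\<ge>\<^sub>0) \<longleftrightarrow>
      (\<forall>t\<in>T. \<forall>u. 0 \<le> (\<Sum>i\<in>I t. \<Sum>j\<in>I t. u i * u j * (\<Sum>k\<in>K. z k * B t k i j)))" for z
  proof -
    have form: "Re (fst t * (\<Sum>i\<in>I t. \<Sum>j\<in>I t. of_real (u i * u j) *
          riesz (Y z) (poly_conj (basis_poly i) * basis_poly j * g (snd t))))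
        = (\<Sum>i\<in>I t. \<Sum>j\<in>I t. u i * u j * (\<Sum>k\<in>K. z k * B t k i j))" for t u
    proof -
      have 1: "Re (c * (of_real a * w)) = a * Re (c * w)" for c w a
        by (simp add: algebra_simps)
      have 2: "Re (fst t * riesz (Y z) p) = (\<Sum>k\<in>K. z k * Re (fst t * riesz (e k) p))" for p
        unfolding Y_def riesz_linear_combination sum_distrib_left Re_sum 1 ..
      show ?thesis
        by (simp only: sum_distrib_left Re_sum B_def 1 2)
    qed
    \<comment> \<open>The index sets depend on \<open>s\<close> alone, so 1 serves as a
      representative multiplier in \<open>I (1, s)\<close>.\<close>
    have "(\<forall>p\<in>quad_module m r \<rho>. riesz (Y z) p \<in> \<real>\<^sub>\<ge>\<^sub>0) \<longleftrightarrow>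
      (\<forall>s u. (\<Sum>i\<in>I (1, s). \<Sum>j\<in>I (1, s). of_real (u i * u j) *
          riesz (Y z) (poly_conj (basis_poly i) * basis_poly j * g s)) \<in> \<real>\<^sub>\<ge>\<^sub>0)"
      unfolding riesz_quad_module_nonneg_iff cpoly_bounded_eq_span
      by (simp add: riesz_square_span riesz_square_span[where g = 1, simplified] all_bool_eq I_def g_def)
    also have "\<dots> \<longleftrightarrow> (\<forall>t\<in>T. \<forall>u. 0 \<le> Re (fst t * (\<Sum>i\<in>I t. \<Sum>j\<in>I t. of_real (u i * u j) *
          riesz (Y z) (poly_conj (basis_poly i) * basis_poly j * g (snd t)))))"
      unfolding nonneg_Reals_iff_Re T_def I_def by fastforce
    finally show ?thesis unfolding form .
  qed
  have "outer_cone m r \<rho> A = (\<lambda>z. \<Sum>k\<in>K. z k *\<^sub>R v k) ` {z. \<forall>t\<in>T. \<forall>u.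
      0 \<le> (\<Sum>i\<in>I t. \<Sum>j\<in>I t. u i * u j * (\<Sum>k\<in>K. z k * B t k i j))}"
    (is "_ = ?p ` ?S")
  proof -
    have p: "?p z = (\<chi> i. Y z (A $ i))" for z
      by (simp add: vec_eq_iff v_def Y_def scaleR_conv_of_real[where 'a = complex])
    show ?thesis
    proof (intro equalityI subsetI)
      fix x assume "x \<in> outer_cone m r \<rho> A"
      then obtain y where x: "x = (\<chi> i. y (A $ i))"
        and y: "\<And>p. p \<in> quad_module m r \<rho> \<Longrightarrow> riesz y p \<in> \<real>\<^sub>\<ge>\<^sub>0"
        by (auto simp: outer_cone_def)
      define z where "z k = (if snd k then Im (y (fst k)) else Re (y (fst k)))" for k
      have Yz: "Y z M = y M" if "M \<in> bounded_indices (2 * r) \<rho>" for M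
        using that by (simp add: Y z_def)
      \<comment> \<open>Every monomial of \<open>q\<close> lies in the range where
        \<open>Y z\<close> and \<open>y\<close> agree.\<close>
      have "riesz (Y z) q = riesz y q" if "q \<in> quad_module m r \<rho>" for q
        using quad_module_cpoly_bounded[OF \<rho> that]
        by (intro riesz_cong Yz) (auto simp: cpoly_bounded_altdef)
      then have "z \<in> ?S" using y by (simp add: psd_iff[symmetric])
      moreover have "x = ?p z" unfolding p x using A by (simp add: Yz)
      ultimately show "x \<in> ?p ` ?S" by blast
    next
      fix x assume "x \<in> ?p ` ?S"
      then obtain z where x: "x = ?p z" and z: "\<And>p. p \<in> quad_module m r \<rho> \<Longrightarrow> riesz (Y z) p \<in> \<real>\<^sub>\<ge>\<^sub>0"
        by (auto simp: psd_iff[symmetric])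
      \<comment> \<open>Square summability is automatic, as \<open>Y z\<close> has finite
        support.\<close>
      have "(\<lambda>M. (cmod (Y z M))\<^sup>2) summable_on UNIV"
        by (rule finite_nonzero_values_imp_summable_on, rule finite_subset[OF _ finite_bounded_indices[of "2 * r" \<rho>]])
          (auto simp: Y)
      then show "x \<in> outer_cone m r \<rho> A"
        unfolding outer_cone_def x p using z by blast
    qed
  qed
  moreover have "finite (I t)" for t by (simp add: I_def finite_bounded_indices)
  moreover have "finite T" by (simp add: T_def)
  ultimately show ?thesis
    using semidefinite_representable_quadratic_forms[OF finK, of T I v B] by simp
qed

section \<open>Moments of measures on the Sobolev ball\<close>

lemma measure_torus: "measure torus_measure (cbox 0 (1 :: real ^ 'n)) = 1"
proof -
  have "cbox 0 (1 :: real ^ 'n) \<noteq> {}" by (simp add: interval_ne_empty_cart)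
  then have "measure lborel (cbox 0 (1 :: real ^ 'n)) = 1"
    by (simp add: content_cbox_if_cart)
  then show ?thesis by (simp add: measure_restrict_space)
qed

lemma finite_measure_torus: "finite_measure (torus_measure :: (real ^ 'n) measure)"
  by (rule finite_measureI) (simp add: emeasure_restrict_space emeasure_lborel_cbox_eq)

lemma square_integrable_imp_integrable_cmod:
  fixes h :: "real ^ 'n \<Rightarrow> complex"
  assumes "h \<in> borel_measurable torus_measure" "integrable torus_measure (\<lambda>x. (cmod (h x))\<^sup>2)"
  shows "integrable torus_measure (\<lambda>x. cmod (h x))"
proof (rule Bochner_Integration.integrable_bound)
  interpret finite_measure "torus_measure :: (real ^ 'n) measure" by (rule finite_measure_torus)
  show "integrable torus_measure (\<lambda>x. 1 + (cmod (h x))\<^sup>2)"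
    using assms by auto
  have "t \<le> 1 + t\<^sup>2" for t :: real
    using zero_le_power2[of "t - 1/2"] by (simp add: power2_eq_square algebra_simps)
  then show "AE x in torus_measure. norm (cmod (h x)) \<le> norm (1 + (cmod (h x))\<^sup>2)"
    by (intro AE_I2) simp
qed (use assms in auto)

text \<open>This is Cauchy-Schwarz against the constant 1, obtained from the nonnegative variance of
  \<open>cmod (h x)\<close> on a space of total mass 1.\<close>

lemma integral_cmod_le_sqrt:
  fixes h :: "real ^ 'n \<Rightarrow> complex"
  assumes "h \<in> borel_measurable torus_measure" "integrable torus_measure (\<lambda>x. (cmod (h x))\<^sup>2)"
  shows "(LINT x|torus_measure. cmod (h x)) \<le> sqrt (LINT x|torus_measure. (cmod (h x))\<^sup>2)"
proof (rule real_le_rsqrt)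
  interpret finite_measure "torus_measure :: (real ^ 'n) measure" by (rule finite_measure_torus)
  define t where "t = (LINT x|torus_measure. cmod (h x))"
  have int: "integrable torus_measure (\<lambda>x. cmod (h x))"
    by (rule square_integrable_imp_integrable_cmod[OF assms])
  have "0 \<le> (LINT x|torus_measure. (cmod (h x) - t)\<^sup>2)" by simp
  also have "\<dots> = (LINT x|torus_measure. (cmod (h x))\<^sup>2 - 2 * t * cmod (h x) + t\<^sup>2)"
    by (simp add: power2_eq_square algebra_simps)
  also have "\<dots> = (LINT x|torus_measure. (cmod (h x))\<^sup>2) - 2 * t * t + t\<^sup>2"
    using assms(2) int by (simp add: t_def measure_torus)
  finally show "t\<^sup>2 \<le> (LINT x|torus_measure. (cmod (h x))\<^sup>2)"
    by (simp add: power2_eq_square)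
qed

lemma cmod_fourier_char [simp]: "cmod (fourier_char a x) = 1"
  by (simp add: fourier_char_def norm_exp_eq_Re)

lemma integrable_times_fourier_char:
  assumes "square_integrable f"
  shows "integrable torus_measure (\<lambda>x. f x * fourier_char a x)"
proof (rule Bochner_Integration.integrable_bound)
  show "integrable torus_measure (\<lambda>x. cmod (f x))"
    using assms by (intro square_integrable_imp_integrable_cmod) (auto simp: square_integrable_def)
  show "(\<lambda>x. f x * fourier_char a x) \<in> borel_measurable torus_measure"
    using assms by (intro borel_measurable_times fourier_char_measurable) (simp add: square_integrable_def)
qed (simp add: norm_mult)

text \<open>Characters have modulus 1, so the difference of the coefficients is bounded by the
  \<open>L^1\<close> distance, and on mass 1 that is bounded by the \<open>L^2\<close>
  distance.\<close>

lemma dist_fourier_coeff_le: "dist (fourier_coeff f a) (fourier_coeff g a) \<le> dist f g"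
proof transfer
  fix f g :: "real ^ 'n \<Rightarrow> complex" and a
  assume "l2_eq f f" "l2_eq g g"
  then have f: "square_integrable f" and g: "square_integrable g" by (auto simp: l2_eq_def)
  have "dist (LINT x|torus_measure. f x * fourier_char a x) (LINT x|torus_measure. g x * fourier_char a x)
      = cmod (LINT x|torus_measure. f x * fourier_char a x - g x * fourier_char a x)"
    using f g by (simp add: dist_norm integrable_times_fourier_char)
  also have "\<dots> \<le> (LINT x|torus_measure. cmod (f x * fourier_char a x - g x * fourier_char a x))"
    by (rule integral_norm_bound)
  also have "\<dots> = (LINT x|torus_measure. cmod (f x - g x))"
    by (simp add: norm_mult flip: left_diff_distrib)
  also have "\<dots> \<le> sqrt (LINT x|torus_measure. (cmod (f x - g x))\<^sup>2)"
    using f g by (intro integral_cmod_le_sqrt square_integrable_diff_integrable)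
      (auto simp: square_integrable_def)
  finally show "dist (LINT x|torus_measure. f x * fourier_char a x)
      (LINT x|torus_measure. g x * fourier_char a x)
      \<le> sqrt (LINT x|torus_measure. (cmod (f x - g x))\<^sup>2)" .
qed

lemma continuous_on_fourier_coeff: "continuous_on S (\<lambda>f. fourier_coeff f a)"
  unfolding continuous_on_iff by (meson dist_fourier_coeff_le le_less_trans)

section \<open>Fourier coefficients on the Sobolev ball\<close>

lemma sobolev_weight_ge_1: "1 \<le> sobolev_weight m a"
  unfolding sobolev_weight_def by (intro one_le_power) simp

lemma sobolev_ball_sum_le:
  assumes f: "f \<in> sobolev_ball m" and X: "finite X"
  shows "(\<Sum>a\<in>X. sobolev_weight m a * (cmod (fourier_coeff f a))\<^sup>2) \<le> 1"
proof -
  have nonneg: "0 \<le> sobolev_weight m a * (cmod (fourier_coeff f a))\<^sup>2" for a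
    using sobolev_weight_ge_1[of m a] by simp
  have "(\<Sum>a\<in>X. sobolev_weight m a * (cmod (fourier_coeff f a))\<^sup>2)
      \<le> (\<Sum>\<^sub>\<infinity>a. sobolev_weight m a * (cmod (fourier_coeff f a))\<^sup>2)"
    using f X nonneg by (intro finite_sum_le_infsum) (auto simp: sobolev_ball_def sobolev_space_def)
  also have "\<dots> \<le> 1"
    using f by (simp add: sobolev_ball_def sobolev_norm_def)
  finally show ?thesis .
qed

lemma cmod_fourier_coeff_le_1:
  assumes "f \<in> sobolev_ball m"
  shows "cmod (fourier_coeff f a) \<le> 1"
proof -
  have "(cmod (fourier_coeff f a))\<^sup>2 \<le> sobolev_weight m a * (cmod (fourier_coeff f a))\<^sup>2"
    using mult_right_mono[OF sobolev_weight_ge_1[of m a], of "(cmod (fourier_coeff f a))\<^sup>2"] by simp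
  also have "\<dots> \<le> 1" using sobolev_ball_sum_le[OF assms, of "{a}"] by simp
  finally show ?thesis by (simp add: abs_square_le_1)
qed

text \<open>A nonzero coefficient can be cancelled from the symmetry identity. Through this lemma
  formal conjugation of polynomials becomes complex conjugation of their values.\<close>

lemma fourier_coeff_uminus:
  assumes "f \<in> modulus_symmetric"
  shows "fourier_coeff f (- a) = cnj (fourier_coeff f a)"
proof (cases "fourier_coeff f a = 0")
  case True
  have "of_real ((cmod (fourier_coeff f (- a)))\<^sup>2) = fourier_coeff f (- a) * fourier_coeff f (- (- a))"
    using assms unfolding modulus_symmetric_def by blast
  with True show ?thesis by simp
next
  case False
  have "of_real ((cmod (fourier_coeff f a))\<^sup>2) = fourier_coeff f a * fourier_coeff f (- a)"
    using assms unfolding modulus_symmetric_def by blast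
  then have "fourier_coeff f a * fourier_coeff f (- a) = fourier_coeff f a * cnj (fourier_coeff f a)"
    by (simp only: complex_norm_square)
  with False show ?thesis by simp
qed

definition fourier_monomial :: "('n::finite) l2_torus \<Rightarrow> (int ^ 'n) multiset \<Rightarrow> complex" where
  "fourier_monomial f M = (\<Prod>a\<in>#M. fourier_coeff f a)"

lemma fourier_monomial_add: "fourier_monomial f (M + N) = fourier_monomial f M * fourier_monomial f N"
  by (simp add: fourier_monomial_def)

lemma fourier_monomial_uminus:
  assumes "f \<in> modulus_symmetric"
  shows "fourier_monomial f (image_mset uminus M) = cnj (fourier_monomial f M)"
  by (induction M) (simp_all add: fourier_monomial_def fourier_coeff_uminus[OF assms])

lemma cmod_fourier_monomial_le_1:
  assumes "f \<in> sobolev_ball m"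
  shows "cmod (fourier_monomial f M) \<le> 1"
  by (induction M) (auto simp: fourier_monomial_def norm_mult
      intro!: mult_le_one cmod_fourier_coeff_le_1[OF assms])

lemma continuous_on_fourier_monomial: "continuous_on S (\<lambda>f. fourier_monomial f M)"
  by (induction M) (auto simp: fourier_monomial_def intro!: continuous_intros continuous_on_fourier_coeff)

lemma riesz_fourier_monomial_poly_conj:
  assumes "f \<in> modulus_symmetric"
  shows "riesz (fourier_monomial f) (poly_conj q) = cnj (riesz (fourier_monomial f) q)"
  by (simp add: poly_conj_def riesz_sum fourier_monomial_uminus[OF assms])
    (simp add: riesz_def)

lemma nonneg_Reals_cnj_mult: "cnj w * w \<in> \<real>\<^sub>\<ge>\<^sub>0"
  by (simp add: complex_nonneg_Reals_iff)

lemma riesz_fourier_monomial_square: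
  assumes "f \<in> modulus_symmetric"
  shows "riesz (fourier_monomial f) (poly_conj q * q) \<in> \<real>\<^sub>\<ge>\<^sub>0"
  by (simp add: riesz_mult fourier_monomial_add riesz_fourier_monomial_poly_conj[OF assms]
      nonneg_Reals_cnj_mult)

lemma riesz_fourier_monomial_ball_poly:
  assumes "f \<in> sobolev_ball m" "f \<in> modulus_symmetric"
  shows "riesz (fourier_monomial f) (ball_poly m \<rho>) \<in> \<real>\<^sub>\<ge>\<^sub>0"
proof -
  have "fourier_coeff f a * fourier_coeff f (- a) = of_real ((cmod (fourier_coeff f a))\<^sup>2)" for a
    using assms(2) by (simp add: modulus_symmetric_def)
  then have "riesz (fourier_monomial f) (ball_poly m \<rho>)
      = of_real (1 - (\<Sum>a | index_degree a \<le> \<rho>. sobolev_weight m a * (cmod (fourier_coeff f a))\<^sup>2))"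
    by (simp add: ball_poly_def riesz_minus riesz_sum fourier_monomial_def)
  moreover have "(\<Sum>a | index_degree a \<le> \<rho>. sobolev_weight m a * (cmod (fourier_coeff f a))\<^sup>2) \<le> 1"
    by (rule sobolev_ball_sum_le[OF assms(1) finite_index_degree_le])
  ultimately show ?thesis by (metis diff_ge_0_iff_ge nonneg_Reals_of_real_iff)
qed

lemma riesz_fourier_monomial_quad_module:
  assumes f: "f \<in> sobolev_ball m" "f \<in> modulus_symmetric" and p: "p \<in> quad_module m r \<rho>"
  shows "riesz (fourier_monomial f) p \<in> \<real>\<^sub>\<ge>\<^sub>0"
proof -
  have "\<forall>p\<in>quad_module m r \<rho>. riesz (fourier_monomial f) p \<in> \<real>\<^sub>\<ge>\<^sub>0"
    unfolding riesz_quad_module_nonneg_iff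
    using riesz_fourier_monomial_square[OF f(2)] riesz_fourier_monomial_ball_poly[OF f]
    by (simp add: riesz_mult[of _ _ "ball_poly m \<rho>"] fourier_monomial_add nonneg_Reals_mult_I)
  with p show ?thesis by blast
qed

lemma radon_measure_on_finite:
  assumes "radon_measure_on S \<mu>"
  shows "finite_measure \<mu>"
proof
  have sets: "sets \<mu> = sets (restrict_space borel S)"
    using assms by (simp add: radon_measure_on_def)
  have space: "space \<mu> = S"
    using sets_eq_imp_space_eq[OF sets] by (simp add: space_restrict_space)
  have meas: "U \<inter> S \<in> sets \<mu>" if "U \<in> sets borel" for U
    using that by (auto simp: sets sets_restrict_space)
  obtain K where K: "K \<subseteq> S" "compact K" "emeasure \<mu> (S - K) < ennreal 1"
    using assms unfolding radon_measure_on_def by (meson zero_less_one)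
  have "\<forall>x\<in>K. \<exists>U. open U \<and> x \<in> U \<and> emeasure \<mu> (U \<inter> S) < \<infinity>"
    using assms K(1) unfolding radon_measure_on_def by blast
  then obtain U where U: "\<And>x. x \<in> K \<Longrightarrow> open (U x) \<and> x \<in> U x \<and> emeasure \<mu> (U x \<inter> S) < \<infinity>"
    by metis
  obtain C where C: "C \<subseteq> K" "finite C" "K \<subseteq> (\<Union>x\<in>C. U x)"
    by (rule compactE_image[OF K(2), of K U]) (use U in auto)
  have "- K \<inter> S \<in> sets \<mu>"
    using K(2) by (intro meas) (simp add: compact_imp_closed borel_closed)
  then have SK: "S - K \<in> sets \<mu>"
    by (simp add: Diff_eq Int_commute)
  have UC: "(\<Union>x\<in>C. U x \<inter> S) \<in> sets \<mu>"
    using U C(1,2) by (intro sets.finite_UN meas) auto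
  have "emeasure \<mu> S \<le> emeasure \<mu> ((S - K) \<union> (\<Union>x\<in>C. U x \<inter> S))"
    using C(3) by (intro emeasure_mono sets.Un SK UC) auto
  also have "\<dots> \<le> emeasure \<mu> (S - K) + emeasure \<mu> (\<Union>x\<in>C. U x \<inter> S)"
    by (rule emeasure_subadditive[OF SK UC])
  also have "\<dots> \<le> emeasure \<mu> (S - K) + (\<Sum>x\<in>C. emeasure \<mu> (U x \<inter> S))"
    using U C(1,2) by (intro add_left_mono emeasure_subadditive_finite) (auto intro!: meas)
  also have "\<dots> < \<infinity>"
    using K(3) U C by (auto simp: less_top[symmetric] ennreal_add_eq_top)
  finally show "emeasure \<mu> (space \<mu>) \<noteq> \<infinity>" by (simp add: space)
qed

lemma moment_cone_subset_outer_cone: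
  fixes A :: "(int ^ 'n) multiset ^ 'k"
  assumes \<rho>: "0 \<le> \<rho>" and A: "\<And>i. A $ i \<in> bounded_indices (2 * r) \<rho>"
  shows "moment_cone m A \<subseteq> outer_cone m r \<rho> A"
proof
  fix x assume "x \<in> moment_cone m A"
  then obtain \<mu> where \<mu>: "radon_measure_on (sobolev_ball m \<inter> modulus_symmetric) \<mu>"
    and x: "\<And>i. x $ i = (LINT f|\<mu>. fourier_monomial f (A $ i))"
    by (auto simp: moment_cone_def fourier_monomial_def)
  interpret finite_measure \<mu> by (rule radon_measure_on_finite[OF \<mu>])
  have sets: "sets \<mu> = sets (restrict_space borel (sobolev_ball m \<inter> modulus_symmetric))"
    using \<mu> by (simp add: radon_measure_on_def)
  have space: "space \<mu> = sobolev_ball m \<inter> modulus_symmetric"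
    using sets_eq_imp_space_eq[OF sets] by (simp add: space_restrict_space)
  have int: "integrable \<mu> (\<lambda>f. fourier_monomial f M)" for M
  proof (rule integrable_const_bound[where B = 1])
    show "AE f in \<mu>. cmod (fourier_monomial f M) \<le> 1"
      by (intro AE_I2 cmod_fourier_monomial_le_1[of _ m]) (simp add: space)
    show "(\<lambda>f. fourier_monomial f M) \<in> borel_measurable \<mu>"
      unfolding measurable_cong_sets[OF sets refl]
      by (intro borel_measurable_continuous_on_restrict continuous_on_fourier_monomial)
  qed
  define y where "y M = (if M \<in> bounded_indices (2 * r) \<rho> then LINT f|\<mu>. fourier_monomial f M else 0)" for M
  have "riesz y p \<in> \<real>\<^sub>\<ge>\<^sub>0" if p: "p \<in> quad_module m r \<rho>" for p
  proof -
    have "riesz y p = riesz (\<lambda>M. LINT f|\<mu>. fourier_monomial f M) p"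
      using quad_module_cpoly_bounded[OF \<rho> p]
      by (intro riesz_cong) (auto simp: y_def cpoly_bounded_altdef)
    also have "\<dots> = (LINT f|\<mu>. riesz (fourier_monomial f) p)"
      unfolding riesz_def using int by simp
    also have "\<dots> = (LINT f|\<mu>. of_real (Re (riesz (fourier_monomial f) p)))"
      using riesz_fourier_monomial_quad_module[OF _ _ p]
      by (intro Bochner_Integration.integral_cong refl) (auto simp: space complex_nonneg_Reals_iff complex_eq_iff)
    also have "\<dots> = of_real (LINT f|\<mu>. Re (riesz (fourier_monomial f) p))"
      by simp
    also have "\<dots> \<in> \<real>\<^sub>\<ge>\<^sub>0"
      using riesz_fourier_monomial_quad_module[OF _ _ p]
      by (auto intro!: Bochner_Integration.integral_nonneg simp: space complex_nonneg_Reals_iff)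
    finally show ?thesis .
  qed
  moreover have "(\<lambda>M. (cmod (y M))\<^sup>2) summable_on UNIV"
    by (rule finite_nonzero_values_imp_summable_on, rule finite_subset[OF _ finite_bounded_indices[of "2 * r" \<rho>]])
      (auto simp: y_def)
  moreover have "x = (\<chi> i. y (A $ i))"
    using A by (simp add: vec_eq_iff x y_def)
  ultimately show "x \<in> outer_cone m r \<rho> A"
    unfolding outer_cone_def by blast
qed

theorem proposition5:
  fixes A :: "(int ^ 'n) multiset ^ 'N" and m :: nat and r \<rho> :: int
  assumes "m \<ge> 1"
    and "r \<ge> max_algebraic_degree A"
    and "\<rho> \<ge> max_harmonic_degree A"
  shows "semidefinite_representable (outer_cone m r \<rho> A) \<and>
         moment_cone m A \<subseteq> outer_cone m r \<rho> A"
proof -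
  have size: "int (size (A $ i)) \<le> r" and harmonic: "harmonic_degree (A $ i) \<le> \<rho>" for i
    using assms(2,3) by (auto simp: max_algebraic_degree_def max_harmonic_degree_def)
  have "0 \<le> \<rho>" using harmonic[of undefined] by (simp add: harmonic_degree_le_iff)
  moreover have "A $ i \<in> bounded_indices (2 * r) \<rho>" for i
    using size[of i] harmonic[of i] by (simp add: bounded_indices_def)
  ultimately show ?thesis
    using semidefinite_representable_outer_cone moment_cone_subset_outer_cone by blast
qed

end
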